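(* Consider a purely kinetic Chaplygin system $(L=\frac12 g,\mathcal D)$ with symmetry group $G$. Let $\overline g$ be a $\mathcal D$-preserving modification of $g$ and $F\in C^\infty(Q)$, and consider the condition $(A')$ for $(\overline g_{ai},F)$ in the form $$\overline g_{bk}R^k_{ac}+\overline g_{ak}R^k_{bc}-g_{bc}X_a(F)-g_{ac}X_b(F)+2g_{ab}X_c(F)=0\quad\text{for all }a,b,c.$$ If $\overline g$ and $F$ are $G$-invariant, then condition $(A')$ is also $G$-invariant (the functions on its left-hand side are $G$-invariant functions on $Q$), and it reduces to a condition on $Q/G$.
   Context: Setting: $Q$ is an $n$-dimensional manifold with Riemannian metric $g$, $\mathcal D\subset TQ$ is a distribution of rank $m$, $L(v)=\frac12g(v,v)$. The system is a (purely kinetic) Chaplygin system: a Lie group $G$ acts freely and properly on $Q$, $\pi:Q\to Q/G$ is the principal bundle, $g$ and $\mathcal D$ are $G$-invariant, and $\mathcal D$ is the horizontal distribution of a principal connection on $\pi$ (so $TQ=\mathcal D\oplus V\pi$, with $V\pi=\ker T\pi$, and $\dim Q/G=m$). Indices $a,b,c=1,\dots,m$; $i,k=1,\dots,n-m$. Summation convention is used. Frames: $V_i$ are the infinitesimal generators of a basis of the Lie algebra of $G$; $X_a$ are the horizontal lifts of the coordinate fields $\partial/\partial q^a$ on $Q/G$. Set $G_{ab}=g(X_a,X_b)$ (inverse $G^{ab}$), $G_{ai}=g(X_a,V_i)$, $K^b_i=-G^{ab}G_{ai}$, $X_i=V_i+K^b_iX_b$. Then $\{X_a,X_i\}$ is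 a local frame with $X_a$ spanning $\mathcal D$ and $X_i$ spanning its $g$-orthogonal complement. Write $[X_\alpha,X_\beta]=R^\gamma_{\alpha\beta}X_\gamma$ in this frame, $g_{ab}=G_{ab}$, $\overline g_{ai}=\overline g(X_a,X_i)$. A symmetric $(0,2)$-tensor field $\overline g$ is a $\mathcal D$-preserving modification of $g$ if $\overline g|_{\mathcal D\times\mathcal D}=g|_{\mathcal D\times\mathcal D}$. The displayed form of $(A')$ is the symmetrization in $a,b$ of $[g_{bd}(\delta_a^dX_c(F)-\delta_c^dX_a(F))+\overline g_{bk}R^k_{ac}]v^av^b=0$ (for all $v^a$). *)

theory Defs
  imports
    "HOL-Analysis.Analysis"
    "HOL-Library.Function_Algebras"
    "HOL-Algebra.Group_Action"
begin

section \<open>Real functions as a vector space\<close>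

text \<open>
  Tangent vectors are derivations, that is, functionals of type \<open>('a \<Rightarrow> real) \<Rightarrow> real\<close>.
  The pointwise structure below lets the library notions \<^const>\<open>subspace\<close>, \<^const>\<open>span\<close> and
  \<^const>\<open>independent\<close> apply to them.
\<close>

instantiation "fun" :: (type, real_vector) real_vector
begin

definition "scaleR_fun c f = (\<lambda>x. c *\<^sub>R f x)"

instance
  by standard (simp_all add: scaleR_fun_def fun_eq_iff algebra_simps)

end

lemma scaleR_fun_apply [simp]: "(c *\<^sub>R f) x = c *\<^sub>R f x"
  by (simp add: scaleR_fun_def)


section \<open>Smooth manifolds\<close>

text \<open>\<open>Ck_on k S f\<close> is only used for open \<open>S\<close>.\<close>

fun Ck_on :: "nat \<Rightarrow> 'a::euclidean_space set \<Rightarrow> ('a \<Rightarrow> 'b::euclidean_space) \<Rightarrow> bool" where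
  "Ck_on 0 S f \<longleftrightarrow> continuous_on S f"
| "Ck_on (Suc k) S f \<longleftrightarrow>
     (\<forall>x\<in>S. f differentiable (at x)) \<and>
     (\<forall>v. Ck_on k S (\<lambda>x. frechet_derivative f (at x) v))"

definition smooth_on :: "'a::euclidean_space set \<Rightarrow> ('a \<Rightarrow> 'b::euclidean_space) \<Rightarrow> bool" where
  "smooth_on S f \<longleftrightarrow> (\<forall>k. Ck_on k S f)"

text \<open>
  A manifold is a whole Hausdorff second countable type with an atlas. An atlas is a set of charts
  \<open>(U, \<phi>)\<close>; it need not be maximal. Only the values of \<open>\<phi>\<close> on \<open>U\<close> matter.
\<close>

type_synonym ('a, 'e) atlas = "('a set \<times> ('a \<Rightarrow> 'e)) set"

definition manifold ::
  "('a::{t2_space,second_countable_topology}, 'e::euclidean_space) atlas \<Rightarrow> bool" where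
  "manifold A \<longleftrightarrow>
     (\<Union>(U, \<phi>)\<in>A. U) = UNIV \<and>
     (\<forall>(U, \<phi>)\<in>A. open U \<and> open (\<phi> ` U) \<and> homeomorphism U (\<phi> ` U) \<phi> (inv_into U \<phi>)) \<and>
     (\<forall>(U, \<phi>)\<in>A. \<forall>(V, \<psi>)\<in>A. smooth_on (\<phi> ` (U \<inter> V)) (\<psi> \<circ> inv_into U \<phi>))"

definition prod_atlas ::
  "('a, 'e) atlas \<Rightarrow> ('b, 'f) atlas \<Rightarrow> ('a \<times> 'b, 'e \<times> 'f) atlas" where
  "prod_atlas A B = {(U \<times> V, map_prod \<phi> \<psi>) | U V \<phi> \<psi>. (U, \<phi>) \<in> A \<and> (V, \<psi>) \<in> B}"

text \<open>In both of the following notions the domain \<open>W\<close> is meant to be open.\<close>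

definition smooth_map ::
  "('a::topological_space, 'e::euclidean_space) atlas
    \<Rightarrow> ('b::topological_space, 'f::euclidean_space) atlas \<Rightarrow> 'a set \<Rightarrow> ('a \<Rightarrow> 'b) \<Rightarrow> bool" where
  "smooth_map A B W f \<longleftrightarrow>
     continuous_on W f \<and>
     (\<forall>(U, \<phi>)\<in>A. \<forall>(V, \<psi>)\<in>B. smooth_on (\<phi> ` (U \<inter> W \<inter> f -` V)) (\<psi> \<circ> f \<circ> inv_into U \<phi>))"

definition smooth_fun :: "('a, 'e::euclidean_space) atlas \<Rightarrow> 'a set \<Rightarrow> ('a \<Rightarrow> real) \<Rightarrow> bool" where
  "smooth_fun A W f \<longleftrightarrow> (\<forall>(U, \<phi>)\<in>A. smooth_on (\<phi> ` (U \<inter> W)) (f \<circ> inv_into U \<phi>))"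

definition diffeomorphism ::
  "('a::topological_space, 'e::euclidean_space) atlas
    \<Rightarrow> ('b::topological_space, 'f::euclidean_space) atlas
    \<Rightarrow> 'a set \<Rightarrow> 'b set \<Rightarrow> ('a \<Rightarrow> 'b) \<Rightarrow> bool" where
  "diffeomorphism A B W W' f \<longleftrightarrow>
     bij_betw f W W' \<and> smooth_map A B W f \<and> smooth_map B A W' (inv_into W f)"


section \<open>Tangent vectors, vector fields and tensor fields\<close>

definition smooth_near ::
  "('a::topological_space, 'e::euclidean_space) atlas \<Rightarrow> 'a \<Rightarrow> ('a \<Rightarrow> real) set" where
  "smooth_near A p = {f. \<exists>N. open N \<and> p \<in> N \<and> smooth_fun A N f}"

type_synonym 'a tvec = "('a \<Rightarrow> real) \<Rightarrow> real"
type_synonym 'a vfield = "'a \<Rightarrow> 'a tvec"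
type_synonym 'a tensor2 = "'a \<Rightarrow> 'a tvec \<Rightarrow> 'a tvec \<Rightarrow> real"

text \<open>
  Derivations at \<open>p\<close> of the algebra of functions that are smooth near \<open>p\<close>. Functions agreeing near \<open>p\<close>
  automatically have the same derivative, since the locally constant function that is 1 on a
  neighbourhood of \<open>p\<close> is smooth near \<open>p\<close> and idempotent. The value on other functions is
  fixed to be 0, so that a derivation is determined by its values on smooth functions.
\<close>

definition tangent_space ::
  "('a::topological_space, 'e::euclidean_space) atlas \<Rightarrow> 'a \<Rightarrow> 'a tvec set" where
  "tangent_space A p = {v.
     (\<forall>f. f \<notin> smooth_near A p \<longrightarrow> v f = 0) \<and>
     (\<forall>f\<in>smooth_near A p. \<forall>h\<in>smooth_near A p. v (\<lambda>x. f x + h x) = v f + v h) \<and>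
     (\<forall>f\<in>smooth_near A p. \<forall>c. v (\<lambda>x. c * f x) = c * v f) \<and>
     (\<forall>f\<in>smooth_near A p. \<forall>h\<in>smooth_near A p. v (\<lambda>x. f x * h x) = v f * h p + f p * v h)}"

lemma subspace_tangent_space: "subspace (tangent_space A p)"
  unfolding subspace_def tangent_space_def by (auto simp: algebra_simps)

definition pushforward ::
  "('b::topological_space, 'f::euclidean_space) atlas \<Rightarrow> ('a \<Rightarrow> 'b) \<Rightarrow> 'a \<Rightarrow> 'a tvec \<Rightarrow> 'b tvec" where
  "pushforward B \<Phi> p v = (\<lambda>f. if f \<in> smooth_near B (\<Phi> p) then v (f \<circ> \<Phi>) else 0)"

definition smooth_vfield ::
  "('a::topological_space, 'e::euclidean_space) atlas \<Rightarrow> 'a set \<Rightarrow> 'a vfield \<Rightarrow> bool" where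
  "smooth_vfield A W X \<longleftrightarrow>
     (\<forall>p\<in>W. X p \<in> tangent_space A p) \<and>
     (\<forall>N f. open N \<and> N \<subseteq> W \<and> smooth_fun A N f \<longrightarrow> smooth_fun A N (\<lambda>p. X p f))"

definition lie_bracket ::
  "('a::topological_space, 'e::euclidean_space) atlas \<Rightarrow> 'a vfield \<Rightarrow> 'a vfield \<Rightarrow> 'a vfield" where
  "lie_bracket A X Y p =
     (\<lambda>f. if f \<in> smooth_near A p then X p (\<lambda>x. Y x f) - Y p (\<lambda>x. X x f) else 0)"

text \<open>The coordinate field \<open>\<partial>/\<partial>x\<^sup>a\<close> of a chart \<open>(U, \<kappa>)\<close>, to be used on \<open>U\<close>.\<close>

definition coord_field ::
  "('b::topological_space, real^'m) atlas \<Rightarrow> 'b set \<Rightarrow> ('b \<Rightarrow> real^'m) \<Rightarrow> 'm::finite \<Rightarrow> 'b vfield" where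
  "coord_field B U \<kappa> a x =
     (\<lambda>f. if f \<in> smooth_near B x
          then frechet_derivative (f \<circ> inv_into U \<kappa>) (at (\<kappa> x)) (axis a 1) else 0)"

definition sym_tensor ::
  "('a::topological_space, 'e::euclidean_space) atlas \<Rightarrow> 'a tensor2 \<Rightarrow> bool" where
  "sym_tensor A t \<longleftrightarrow>
     (\<forall>p. \<forall>u\<in>tangent_space A p. \<forall>v\<in>tangent_space A p. t p u v = t p v u) \<and>
     (\<forall>p. \<forall>u\<in>tangent_space A p. \<forall>v\<in>tangent_space A p. \<forall>w\<in>tangent_space A p. \<forall>c.
        t p (u + v) w = t p u w + t p v w \<and> t p (c *\<^sub>R u) w = c * t p u w) \<and>
     (\<forall>N X Y. open N \<and> smooth_vfield A N X \<and> smooth_vfield A N Y \<longrightarrow>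
        smooth_fun A N (\<lambda>p. t p (X p) (Y p)))"

definition riemannian_metric ::
  "('a::topological_space, 'e::euclidean_space) atlas \<Rightarrow> 'a tensor2 \<Rightarrow> bool" where
  "riemannian_metric A g \<longleftrightarrow>
     sym_tensor A g \<and> (\<forall>p. \<forall>v\<in>tangent_space A p. v \<noteq> 0 \<longrightarrow> g p v v > 0)"

definition distribution ::
  "('a::topological_space, 'e::euclidean_space) atlas \<Rightarrow> nat \<Rightarrow> ('a \<Rightarrow> 'a tvec set) \<Rightarrow> bool" where
  "distribution A r D \<longleftrightarrow>
     (\<forall>p. \<exists>N W. open N \<and> p \<in> N \<and> (\<forall>i<r. smooth_vfield A N (W i)) \<and>
        (\<forall>x\<in>N. inj_on (\<lambda>i. W i x) {..<r} \<and> independent ((\<lambda>i. W i x) ` {..<r}) \<and>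
               D x = span ((\<lambda>i. W i x) ` {..<r})))"


section \<open>Lie group actions and principal bundles\<close>

definition lie_group ::
  "('g::{t2_space,second_countable_topology}, 'e::euclidean_space) atlas \<Rightarrow> 'g monoid \<Rightarrow> bool" where
  "lie_group A G \<longleftrightarrow>
     manifold A \<and> group G \<and> carrier G = UNIV \<and>
     smooth_map (prod_atlas A A) A UNIV (\<lambda>(x, y). x \<otimes>\<^bsub>G\<^esub> y) \<and>
     smooth_map A A UNIV (\<lambda>x. inv\<^bsub>G\<^esub> x)"

definition free_proper_action ::
  "('q::topological_space, 'e::euclidean_space) atlas
    \<Rightarrow> ('g::topological_space, 'f::euclidean_space) atlas
    \<Rightarrow> 'g monoid \<Rightarrow> ('g \<Rightarrow> 'q \<Rightarrow> 'q) \<Rightarrow> bool" where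
  "free_proper_action AQ AG G \<Phi> \<longleftrightarrow>
     group_action G UNIV \<Phi> \<and>
     smooth_map (prod_atlas AG AQ) AQ UNIV (\<lambda>(h, q). \<Phi> h q) \<and>
     (\<forall>q. stabilizer G \<Phi> q = {\<one>\<^bsub>G\<^esub>}) \<and>
     proper_map euclidean euclidean (\<lambda>(h, q). (\<Phi> h q, q))"

text \<open>
  The base \<open>Q/G\<close> is represented by a manifold whose points correspond, via the surjection \<open>\<pi>\<close>, to the
  \<open>G\<close>-orbits. Since \<open>\<pi>\<close> has equivariant local trivializations, this is the
  quotient manifold, up to a unique diffeomorphism compatible with the projections.
\<close>

definition principal_bundle ::
  "('q::topological_space, 'e::euclidean_space) atlas
    \<Rightarrow> ('b::topological_space, 'd::euclidean_space) atlas
    \<Rightarrow> ('g::topological_space, 'f::euclidean_space) atlas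
    \<Rightarrow> 'g monoid \<Rightarrow> ('g \<Rightarrow> 'q \<Rightarrow> 'q) \<Rightarrow> ('q \<Rightarrow> 'b) \<Rightarrow> bool" where
  "principal_bundle AQ AB AG G \<Phi> \<pi> \<longleftrightarrow>
     smooth_map AQ AB UNIV \<pi> \<and> surj \<pi> \<and>
     (\<forall>q q'. \<pi> q = \<pi> q' \<longleftrightarrow> orbit G \<Phi> q = orbit G \<Phi> q') \<and>
     (\<forall>x. \<exists>N \<tau>. open N \<and> x \<in> N \<and>
        diffeomorphism AQ (prod_atlas AB AG) (\<pi> -` N) (N \<times> UNIV) (\<lambda>q. (\<pi> q, \<tau> q)) \<and>
        (\<forall>q\<in>\<pi> -` N. \<forall>h. \<tau> (\<Phi> h q) = h \<otimes>\<^bsub>G\<^esub> \<tau> q))"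

definition vertical ::
  "('q::topological_space, 'e::euclidean_space) atlas
    \<Rightarrow> ('b::topological_space, 'd::euclidean_space) atlas
    \<Rightarrow> ('q \<Rightarrow> 'b) \<Rightarrow> 'q \<Rightarrow> 'q tvec set" where
  "vertical AQ AB \<pi> q = {v \<in> tangent_space AQ q. pushforward AB \<pi> q v = 0}"

definition invariant_tensor ::
  "('q::topological_space, 'e::euclidean_space) atlas \<Rightarrow> ('g \<Rightarrow> 'q \<Rightarrow> 'q) \<Rightarrow> 'q tensor2 \<Rightarrow> bool" where
  "invariant_tensor AQ \<Phi> t \<longleftrightarrow>
     (\<forall>h q. \<forall>u\<in>tangent_space AQ q. \<forall>v\<in>tangent_space AQ q.
        t (\<Phi> h q) (pushforward AQ (\<Phi> h) q u) (pushforward AQ (\<Phi> h) q v) = t q u v)"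

definition invariant_distribution ::
  "('q::topological_space, 'e::euclidean_space) atlas
    \<Rightarrow> ('g \<Rightarrow> 'q \<Rightarrow> 'q) \<Rightarrow> ('q \<Rightarrow> 'q tvec set) \<Rightarrow> bool" where
  "invariant_distribution AQ \<Phi> D \<longleftrightarrow> (\<forall>h q. pushforward AQ (\<Phi> h) q ` D q = D (\<Phi> h q))"

definition invariant_fun_on :: "('g \<Rightarrow> 'q \<Rightarrow> 'q) \<Rightarrow> 'q set \<Rightarrow> ('q \<Rightarrow> real) \<Rightarrow> bool" where
  "invariant_fun_on \<Phi> W f \<longleftrightarrow> (\<forall>h. \<forall>q\<in>W. f (\<Phi> h q) = f q)"

text \<open>
  A principal connection is given by its horizontal distribution: a smooth invariant distribution
  complementary to the vertical bundle.
\<close>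

definition principal_connection ::
  "('q::topological_space, 'e::euclidean_space) atlas
    \<Rightarrow> ('b::topological_space, 'd::euclidean_space) atlas
    \<Rightarrow> ('g \<Rightarrow> 'q \<Rightarrow> 'q) \<Rightarrow> ('q \<Rightarrow> 'b) \<Rightarrow> ('q \<Rightarrow> 'q tvec set) \<Rightarrow> bool" where
  "principal_connection AQ AB \<Phi> \<pi> D \<longleftrightarrow>
     distribution AQ DIM('d) D \<and> invariant_distribution AQ \<Phi> D \<and>
     (\<forall>q. D q \<inter> vertical AQ AB \<pi> q = {0} \<and>
          {u + v | u v. u \<in> D q \<and> v \<in> vertical AQ AB \<pi> q} = tangent_space AQ q)"

definition horizontal_lift ::
  "('q::topological_space, 'e::euclidean_space) atlas
    \<Rightarrow> ('b::topological_space, 'd::euclidean_space) atlas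
    \<Rightarrow> ('q \<Rightarrow> 'b) \<Rightarrow> ('q \<Rightarrow> 'q tvec set) \<Rightarrow> 'b set \<Rightarrow> 'b vfield \<Rightarrow> 'q vfield \<Rightarrow> bool" where
  "horizontal_lift AQ AB \<pi> D U Y X \<longleftrightarrow>
     smooth_vfield AQ (\<pi> -` U) X \<and>
     (\<forall>q\<in>\<pi> -` U. X q \<in> D q \<and> pushforward AB \<pi> q (X q) = Y (\<pi> q))"

text \<open>
  The Lie algebra of \<open>G\<close> is the tangent space at the unit; \<open>\<xi>\<close> is sent to the field whose value at \<open>q\<close>
  is the image of \<open>\<xi>\<close> under the tangent map of \<open>h \<mapsto> \<Phi> h q\<close>, which is
  the velocity at \<open>t = 0\<close> of \<open>\<Phi> (exp (t \<xi>)) q\<close>.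
\<close>

definition infinitesimal_generator ::
  "('q::topological_space, 'e::euclidean_space) atlas
    \<Rightarrow> 'g monoid \<Rightarrow> ('g \<Rightarrow> 'q \<Rightarrow> 'q) \<Rightarrow> 'g tvec \<Rightarrow> 'q vfield" where
  "infinitesimal_generator AQ G \<Phi> \<xi> q = pushforward AQ (\<lambda>h. \<Phi> h q) \<one>\<^bsub>G\<^esub> \<xi>"

definition lie_algebra_basis ::
  "('g::topological_space, 'f::euclidean_space) atlas \<Rightarrow> 'g monoid \<Rightarrow> ('k \<Rightarrow> 'g tvec) \<Rightarrow> bool" where
  "lie_algebra_basis AG G \<xi> \<longleftrightarrow>
     inj \<xi> \<and> independent (range \<xi>) \<and> span (range \<xi>) = tangent_space AG \<one>\<^bsub>G\<^esub>"


section \<open>Purely kinetic Chaplygin systems\<close>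

text \<open>
  The kinetic Lagrangian \<open>L(v) = g(v, v)/2\<close> is determined by \<open>g\<close> and determines it, so the
  system is given by \<open>g\<close> and \<open>D\<close>. Here \<open>dim Q = n\<close>, \<open>dim Q/G = m\<close> and \<open>dim G = n - m\<close> are the
  cardinalities of \<open>'n\<close>, \<open>'m\<close> and \<open>'k\<close>.
\<close>

definition chaplygin_system ::
  "('q::{t2_space,second_countable_topology}, real^'n::finite) atlas
    \<Rightarrow> ('b::{t2_space,second_countable_topology}, real^'m::finite) atlas
    \<Rightarrow> ('g::{t2_space,second_countable_topology}, real^'k::finite) atlas
    \<Rightarrow> 'g monoid \<Rightarrow> ('g \<Rightarrow> 'q \<Rightarrow> 'q) \<Rightarrow> ('q \<Rightarrow> 'b)
    \<Rightarrow> 'q tensor2 \<Rightarrow> ('q \<Rightarrow> 'q tvec set) \<Rightarrow> bool" where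
  "chaplygin_system AQ AB AG G \<Phi> \<pi> g D \<longleftrightarrow>
     CARD('n) = CARD('m) + CARD('k) \<and>
     manifold AQ \<and> manifold AB \<and> lie_group AG G \<and>
     free_proper_action AQ AG G \<Phi> \<and> principal_bundle AQ AB AG G \<Phi> \<pi> \<and>
     riemannian_metric AQ g \<and> invariant_tensor AQ \<Phi> g \<and>
     principal_connection AQ AB \<Phi> \<pi> D"

definition D_preserving_modification ::
  "('q::topological_space, 'e::euclidean_space) atlas
    \<Rightarrow> ('q \<Rightarrow> 'q tvec set) \<Rightarrow> 'q tensor2 \<Rightarrow> 'q tensor2 \<Rightarrow> bool" where
  "D_preserving_modification AQ D g g' \<longleftrightarrow>
     sym_tensor AQ g' \<and> (\<forall>q. \<forall>u\<in>D q. \<forall>v\<in>D q. g' q u v = g q u v)"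

definition gram :: "'q tensor2 \<Rightarrow> ('m::finite \<Rightarrow> 'q vfield) \<Rightarrow> 'q \<Rightarrow> real^'m^'m" where
  "gram g X q = (\<chi> a b. g q (X a q) (X b q))"

definition K_coeff ::
  "'q tensor2 \<Rightarrow> ('m::finite \<Rightarrow> 'q vfield) \<Rightarrow> ('k \<Rightarrow> 'q vfield) \<Rightarrow> 'm \<Rightarrow> 'k \<Rightarrow> 'q \<Rightarrow> real" where
  "K_coeff g X V b i q = - (\<Sum>a\<in>UNIV. matrix_inv (gram g X q) $ a $ b * g q (X a q) (V i q))"

text \<open>The frame \<open>{X\<^sub>a, X\<^sub>i}\<close>, indexed by the disjoint sum: \<open>Inl a\<close> for \<open>X\<^sub>a\<close> and \<open>Inr i\<close> for \<open>X\<^sub>i\<close>.\<close>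

definition adapted_frame ::
  "'q tensor2 \<Rightarrow> ('m::finite \<Rightarrow> 'q vfield) \<Rightarrow> ('k \<Rightarrow> 'q vfield) \<Rightarrow> 'm + 'k \<Rightarrow> 'q vfield" where
  "adapted_frame g X V \<alpha> q =
     (case \<alpha> of Inl a \<Rightarrow> X a q
              | Inr i \<Rightarrow> V i q + (\<Sum>b\<in>UNIV. K_coeff g X V b i q *\<^sub>R X b q))"

text \<open>\<open>R \<gamma> \<alpha> \<beta>\<close> is the coefficient of \<open>E \<gamma>\<close> in the bracket of \<open>E \<alpha>\<close> and \<open>E \<beta>\<close>.\<close>

definition structure_functions ::
  "('q::topological_space, 'e::euclidean_space) atlas \<Rightarrow> 'q set
    \<Rightarrow> ('i::finite \<Rightarrow> 'q vfield) \<Rightarrow> ('i \<Rightarrow> 'i \<Rightarrow> 'i \<Rightarrow> 'q \<Rightarrow> real) \<Rightarrow> bool" where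
  "structure_functions AQ W E R \<longleftrightarrow>
     (\<forall>q\<in>W. \<forall>\<alpha> \<beta>. lie_bracket AQ (E \<alpha>) (E \<beta>) q = (\<Sum>\<gamma>\<in>UNIV. R \<gamma> \<alpha> \<beta> q *\<^sub>R E \<gamma> q))"

definition curvature_term ::
  "'q tensor2 \<Rightarrow> ('m + 'k::finite \<Rightarrow> 'q vfield)
    \<Rightarrow> ('m + 'k \<Rightarrow> 'm + 'k \<Rightarrow> 'm + 'k \<Rightarrow> 'q \<Rightarrow> real)
    \<Rightarrow> 'm \<Rightarrow> 'm \<Rightarrow> 'm \<Rightarrow> 'q \<Rightarrow> real" where
  "curvature_term g' E R b a c q =
     (\<Sum>k\<in>UNIV. g' q (E (Inl b) q) (E (Inr k) q) * R (Inr k) (Inl a) (Inl c) q)"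

definition A'_lhs ::
  "'q tensor2 \<Rightarrow> 'q tensor2 \<Rightarrow> ('q \<Rightarrow> real) \<Rightarrow> ('m + 'k::finite \<Rightarrow> 'q vfield)
    \<Rightarrow> ('m + 'k \<Rightarrow> 'm + 'k \<Rightarrow> 'm + 'k \<Rightarrow> 'q \<Rightarrow> real)
    \<Rightarrow> 'm \<Rightarrow> 'm \<Rightarrow> 'm \<Rightarrow> 'q \<Rightarrow> real" where
  "A'_lhs g g' F E R a b c q =
     curvature_term g' E R b a c q + curvature_term g' E R a b c q
     - g q (E (Inl b) q) (E (Inl c) q) * E (Inl a) q F
     - g q (E (Inl a) q) (E (Inl c) q) * E (Inl b) q F
     + 2 * g q (E (Inl a) q) (E (Inl b) q) * E (Inl c) q F"

end

theory Submission
  imports Defs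
begin

text \<open>
  The fields \<open>X\<^sub>i\<close> are \<open>g\<close>-orthogonal to \<open>D\<close>, and \<open>g' - g\<close> vanishes on \<open>D\<close>; hence
  \<open>g'(X\<^sub>b, X\<^sub>k) R\<^sup>k\<^sub>a\<^sub>c = g'(X\<^sub>b, [X\<^sub>a, X\<^sub>c]) - g(X\<^sub>b, [X\<^sub>a, X\<^sub>c])\<close>, which no longer mentions the vertical
  part of the frame. An element of \<open>D\<close> is determined by its projection to the base, so horizontal
  lifts and therefore their brackets are invariant, and all the coefficients in (A') are smooth
  invariant functions. Such functions descend to the base through local sections of the bundle.
\<close>


section \<open>Calculus of \<open>C\<^sup>k\<close> functions\<close>

text \<open>The curvature summands of (A') cannot be treated factor by factor. The generators
  \<open>V i\<close> are in general moved by the group through the adjoint representation, so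
  neither g'(X_b, X_k) nor the coefficients \<open>R (Inr k)\<close> need be invariant; only their
  contraction is. Moreover \<open>R\<close> is given pointwise by an expansion, with no smoothness
  stated, so smoothness too has to be read off from the rewritten contraction. Two features of the
  encoding shape the rest. Tangent vectors are functionals that vanish on functions not smooth near
  the point, so every transport of a vector carries the obligation that pulled back test functions
  are smooth near the right point. And smoothness in a chart is a recursion on derivatives in fixed
  directions, so the chain rule has to be brought into that form.\<close>

lemma Ck_on_SucD: "Ck_on (Suc k) S f \<Longrightarrow> Ck_on k S f"
proof (induction k arbitrary: f)
  case 0
  then show ?case
    by (auto intro!: continuous_at_imp_continuous_on differentiable_imp_continuous_within)
next
  case (Suc k)
  then show ?case by auto
qed

lemma Ck_on_subset: "Ck_on k S f \<Longrightarrow> T \<subseteq> S \<Longrightarrow> Ck_on k T f"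
  by (induction k arbitrary: f) (auto intro: continuous_on_subset)

lemma frechet_derivative_cong_open:
  assumes "open S" "x \<in> S" "\<And>y. y \<in> S \<Longrightarrow> f y = g y" "f differentiable (at x)"
  shows "g differentiable (at x)" "frechet_derivative g (at x) = frechet_derivative f (at x)"
proof -
  have "(f has_derivative frechet_derivative f (at x)) (at x)"
    using assms(4) frechet_derivative_works by blast
  then have "(g has_derivative frechet_derivative f (at x)) (at x)"
    using assms(1-3) by (rule has_derivative_transform_within_open)
  then show "g differentiable (at x)" "frechet_derivative g (at x) = frechet_derivative f (at x)"
    by (auto simp: differentiable_def frechet_derivative_at[symmetric])
qed

text \<open>\<open>frechet_derivative\<close> at a point sees the function on a neighbourhood, so
  equality on \<open>S\<close> passes to all derivatives because \<open>S\<close> is open. The rules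
  below use this to replace the derivative of a compound by its explicit formula, which is known at
  points of \<open>S\<close> only.\<close>

lemma Ck_on_cong:
  "Ck_on k S f \<Longrightarrow> open S \<Longrightarrow> (\<And>x. x \<in> S \<Longrightarrow> f x = g x) \<Longrightarrow> Ck_on k S g"
proof (induction k arbitrary: f g)
  case 0
  then show ?case using continuous_on_eq by auto
next
  case (Suc k)
  have *: "g differentiable (at x)" "frechet_derivative g (at x) = frechet_derivative f (at x)"
    if "x \<in> S" for x
    using frechet_derivative_cong_open[OF \<open>open S\<close> that, of f g] Suc.prems that by auto
  have "Ck_on k S (\<lambda>x. frechet_derivative g (at x) v)" for v
    by (rule Suc.IH[of "\<lambda>x. frechet_derivative f (at x) v"]) (use Suc.prems * in auto)
  then show ?case using * by simp
qed

text \<open>The derivatives of \<open>f\<close> live on the neighbourhood given for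
  \<open>f\<close>, so the induction keeps it. This permits shrinking to a set on which a map stays
  inside one chart.\<close>

lemma Ck_on_local:
  assumes "\<And>x. x \<in> S \<Longrightarrow> \<exists>T. open T \<and> x \<in> T \<and> Ck_on k T f"
  shows "Ck_on k S f"
  using assms
proof (induction k arbitrary: f)
  case 0
  have "continuous (at x) f" if "x \<in> S" for x
    using 0[OF that] continuous_on_eq_continuous_at by auto
  then show ?case by (simp add: continuous_at_imp_continuous_on)
next
  case (Suc k)
  have "Ck_on k S (\<lambda>x. frechet_derivative f (at x) v)" for v
    by (rule Suc.IH) (use Suc.prems in fastforce)
  then show ?case using Suc.prems by fastforce
qed

lemma Ck_on_const: "Ck_on k S (\<lambda>x. c)"
  by (induction k arbitrary: c) auto

text \<open>The derivative in direction \<open>v\<close> is the constant \<open>f v\<close>, so one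
  unfolding leads to \<open>Ck_on_const\<close>.\<close>

lemma Ck_on_bounded_linear: "bounded_linear f \<Longrightarrow> Ck_on k S f"
proof (cases k)
  case (Suc j)
  assume f: "bounded_linear f"
  have "f differentiable (at x)" "frechet_derivative f (at x) = f" for x
    using bounded_linear_imp_has_derivative[OF f, of "at x"] frechet_derivative_at
    by (auto simp: differentiable_def dest: frechet_derivative_at)
  then show ?thesis by (simp add: Suc Ck_on_const)
qed (simp add: linear_continuous_on)

lemma Ck_on_add:
  "Ck_on k S f \<Longrightarrow> Ck_on k S g \<Longrightarrow> open S \<Longrightarrow> Ck_on k S (\<lambda>x. f x + g x)"
proof (induction k arbitrary: f g)
  case 0
  then show ?case by (simp add: continuous_on_add)
next
  case (Suc k)
  have D: "((\<lambda>x. f x + g x) has_derivative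
      (\<lambda>v. frechet_derivative f (at x) v + frechet_derivative g (at x) v)) (at x)" if "x \<in> S" for x
    using Suc.prems that
    by (intro has_derivative_add) (auto simp: frechet_derivative_works[symmetric])
  have "Ck_on k S (\<lambda>x. frechet_derivative (\<lambda>x. f x + g x) (at x) v)" for v
  proof (rule Ck_on_cong)
    show "Ck_on k S (\<lambda>x. frechet_derivative f (at x) v + frechet_derivative g (at x) v)"
      using Suc.prems by (intro Suc.IH) auto
    show "frechet_derivative f (at x) v + frechet_derivative g (at x) v =
        frechet_derivative (\<lambda>x. f x + g x) (at x) v" if "x \<in> S" for x
      by (rule fun_cong[OF frechet_derivative_at[OF D[OF that]]])
  qed fact
  then show ?case using D by (auto simp: differentiable_def)
qed

text \<open>Each summand of the product rule has one undifferentiated factor, which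
  \<open>Ck_on_SucD\<close> lowers to level \<open>k\<close>. The vector-valued form covers both
  products of real functions and the basis expansion in the chain rule.\<close>

lemma Ck_on_scaleR:
  fixes c :: "'a::euclidean_space \<Rightarrow> real"
  shows "Ck_on k S c \<Longrightarrow> Ck_on k S g \<Longrightarrow> open S \<Longrightarrow> Ck_on k S (\<lambda>x. c x *\<^sub>R g x)"
proof (induction k arbitrary: c g)
  case 0
  then show ?case by (simp add: continuous_on_scaleR)
next
  case (Suc k)
  have D: "((\<lambda>x. c x *\<^sub>R g x) has_derivative (\<lambda>v. c x *\<^sub>R frechet_derivative g (at x) v +
      frechet_derivative c (at x) v *\<^sub>R g x)) (at x)" if "x \<in> S" for x
    using Suc.prems that
    by (intro has_derivative_scaleR) (auto simp: frechet_derivative_works[symmetric])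
  have "Ck_on k S (\<lambda>x. frechet_derivative (\<lambda>x. c x *\<^sub>R g x) (at x) v)" for v
  proof (rule Ck_on_cong)
    show "Ck_on k S (\<lambda>x. c x *\<^sub>R frechet_derivative g (at x) v +
        frechet_derivative c (at x) v *\<^sub>R g x)"
      using Suc.prems Ck_on_SucD[OF Suc.prems(1)] Ck_on_SucD[OF Suc.prems(2)]
      by (intro Ck_on_add Suc.IH) auto
    show "open S" by fact
    show "c x *\<^sub>R frechet_derivative g (at x) v + frechet_derivative c (at x) v *\<^sub>R g x =
        frechet_derivative (\<lambda>x. c x *\<^sub>R g x) (at x) v" if "x \<in> S" for x
      by (rule fun_cong[OF frechet_derivative_at[OF D[OF that]]])
  qed
  then show ?case using D by (auto simp: differentiable_def)
qed

lemma Ck_on_linear_comp: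
  assumes "bounded_linear L"
  shows "Ck_on k S f \<Longrightarrow> open S \<Longrightarrow> Ck_on k S (\<lambda>x. L (f x))"
proof (induction k arbitrary: f)
  case 0
  then show ?case using assms by (simp add: bounded_linear.continuous_on)
next
  case (Suc k)
  have D: "((\<lambda>x. L (f x)) has_derivative (\<lambda>v. L (frechet_derivative f (at x) v))) (at x)"
    if "x \<in> S" for x
    using Suc.prems that
    by (intro bounded_linear.has_derivative[OF assms]) (auto simp: frechet_derivative_works[symmetric])
  have "Ck_on k S (\<lambda>x. frechet_derivative (\<lambda>x. L (f x)) (at x) v)" for v
  proof (rule Ck_on_cong)
    show "Ck_on k S (\<lambda>x. L (frechet_derivative f (at x) v))"
      using Suc.prems by (intro Suc.IH) auto
    show "L (frechet_derivative f (at x) v) = frechet_derivative (\<lambda>x. L (f x)) (at x) v"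
      if "x \<in> S" for x
      by (rule fun_cong[OF frechet_derivative_at[OF D[OF that]]])
  qed fact
  then show ?case using D by (auto simp: differentiable_def)
qed

lemma Ck_on_sum:
  assumes "finite I" "\<And>i. i \<in> I \<Longrightarrow> Ck_on k S (f i)" "open S"
  shows "Ck_on k S (\<lambda>x. \<Sum>i\<in>I. f i x)"
  using assms by (induction I rule: finite_induct) (auto intro: Ck_on_const Ck_on_add)

text \<open>The chain rule evaluates the derivative of \<open>g\<close> in the direction
  \<open>frechet_derivative f (at x) v\<close>, which varies with \<open>x\<close>, while
  \<open>Ck_on\<close> speaks of fixed directions. Expanding that vector in \<open>Basis\<close>
  leaves derivatives of \<open>g\<close> in fixed directions, composed with \<open>f\<close>, with
  scalar coefficients from the derivative of \<open>f\<close>. Hence the induction varies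
  \<open>g\<close> and keeps \<open>f\<close>.\<close>

lemma Ck_on_comp:
  assumes "open S" "open T" "f ` S \<subseteq> T"
  shows "Ck_on k T g \<Longrightarrow> Ck_on k S f \<Longrightarrow> Ck_on k S (\<lambda>x. g (f x))"
proof (induction k arbitrary: g)
  case 0
  then show ?case
    using assms continuous_on_compose2[of T g S f] by simp
next
  case (Suc k)
  have D: "((\<lambda>x. g (f x)) has_derivative
      (\<lambda>v. frechet_derivative g (at (f x)) (frechet_derivative f (at x) v))) (at x)"
    and lin: "linear (frechet_derivative g (at (f x)))" if "x \<in> S" for x
  proof -
    have f: "(f has_derivative frechet_derivative f (at x)) (at x)"
      and g: "(g has_derivative frechet_derivative g (at (f x))) (at (f x))"
      using Suc.prems that assms(3) by (auto simp: frechet_derivative_works[symmetric])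
    show "((\<lambda>x. g (f x)) has_derivative
      (\<lambda>v. frechet_derivative g (at (f x)) (frechet_derivative f (at x) v))) (at x)"
      using has_derivative_compose[OF f g] .
    show "linear (frechet_derivative g (at (f x)))"
      using g has_derivative_linear by blast
  qed
  have "Ck_on k S (\<lambda>x. frechet_derivative (\<lambda>x. g (f x)) (at x) v)" for v
  proof (rule Ck_on_cong)
    show "Ck_on k S (\<lambda>x. \<Sum>i\<in>Basis. (frechet_derivative f (at x) v \<bullet> i) *\<^sub>R
        frechet_derivative g (at (f x)) i)"
      using Suc.prems Ck_on_SucD[OF Suc.prems(2)] assms
      by (intro Ck_on_sum Ck_on_scaleR Suc.IH
          Ck_on_linear_comp[OF bounded_linear_inner_left]) auto
    show "(\<Sum>i\<in>Basis. (frechet_derivative f (at x) v \<bullet> i) *\<^sub>R frechet_derivative g (at (f x)) i) =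
        frechet_derivative (\<lambda>x. g (f x)) (at x) v" if "x \<in> S" for x
    proof -
      have "frechet_derivative (\<lambda>x. g (f x)) (at x) v =
          frechet_derivative g (at (f x)) (frechet_derivative f (at x) v)"
        by (rule fun_cong[OF frechet_derivative_at[OF D[OF that]], symmetric])
      also have "\<dots> = frechet_derivative g (at (f x))
          (\<Sum>i\<in>Basis. (frechet_derivative f (at x) v \<bullet> i) *\<^sub>R i)"
        by (simp add: euclidean_representation)
      finally show ?thesis
        by (simp add: linear_sum[OF lin[OF that]] linear_cmul[OF lin[OF that]])
    qed
  qed fact
  then show ?case using D by (auto simp: differentiable_def)
qed


section \<open>Smooth functions on manifolds\<close>

text \<open>This is \<open>manifold\<close> without the smoothness of transition maps. The calculus
  of functions in charts rests on this part alone, so a product atlas has to be checked only this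
  far.\<close>

definition open_charts ::
  "('a::topological_space, 'e::euclidean_space) atlas \<Rightarrow> bool" where
  "open_charts A \<longleftrightarrow>
     (\<Union>(U, \<phi>)\<in>A. U) = UNIV \<and>
     (\<forall>(U, \<phi>)\<in>A. open U \<and> open (\<phi> ` U) \<and> homeomorphism U (\<phi> ` U) \<phi> (inv_into U \<phi>))"

lemma manifold_open_charts: "manifold A \<Longrightarrow> open_charts A"
  by (simp add: manifold_def open_charts_def)

lemma chart_at:
  assumes "open_charts A"
  obtains U \<phi> where "(U, \<phi>) \<in> A" "x \<in> U"
proof -
  have "x \<in> (\<Union>(U, \<phi>)\<in>A. U)" using assms by (simp add: open_charts_def)
  then show ?thesis using that by auto
qed

lemma chart_props:
  assumes "open_charts A" "(U, \<phi>) \<in> A"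
  shows "open U" "open (\<phi> ` U)" "continuous_on U \<phi>" "inj_on \<phi> U"
    "N \<subseteq> U \<Longrightarrow> open N \<Longrightarrow> open (\<phi> ` N)"
    "x \<in> U \<Longrightarrow> inv_into U \<phi> (\<phi> x) = x"
proof -
  have h: "open U" "open (\<phi> ` U)" "homeomorphism U (\<phi> ` U) \<phi> (inv_into U \<phi>)"
    using assms by (auto simp: open_charts_def)
  show "open U" "open (\<phi> ` U)" by fact+
  show "continuous_on U \<phi>" using h homeomorphism_cont1 by blast
  show "inj_on \<phi> U"
    using homeomorphism_apply1[OF h(3)] by (intro inj_on_inverseI[of U "inv_into U \<phi>"])
  then show "x \<in> U \<Longrightarrow> inv_into U \<phi> (\<phi> x) = x" by simp
  assume "N \<subseteq> U" "open N"
  then have "openin (top_of_set (\<phi> ` U)) (\<phi> ` N)"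
    using homeomorphism_imp_open_map[OF h(3)] h(1) by (simp add: openin_open_eq)
  then show "open (\<phi> ` N)" using h(2) openin_open_trans by blast
qed

lemma inv_into_map_prod:
  assumes "inj_on \<phi> U" "inj_on \<psi> V" "y \<in> \<phi> ` U" "z \<in> \<psi> ` V"
  shows "inv_into (U \<times> V) (map_prod \<phi> \<psi>) (y, z) = (inv_into U \<phi> y, inv_into V \<psi> z)"
proof (rule inv_into_f_eq)
  show "inj_on (map_prod \<phi> \<psi>) (U \<times> V)" using assms by (simp add: map_prod_inj_on)
  show "(inv_into U \<phi> y, inv_into V \<psi> z) \<in> U \<times> V"
    using assms(3,4) by (simp add: inv_into_into)
  show "map_prod \<phi> \<psi> (inv_into U \<phi> y, inv_into V \<psi> z) = (y, z)"
    using assms(3,4) by (simp add: f_inv_into_f)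
qed

lemma open_charts_prod_atlas:
  assumes A: "open_charts A" and B: "open_charts B"
  shows "open_charts (prod_atlas A B)"
proof -
  have "\<exists>C\<in>prod_atlas A B. (x, y) \<in> fst C" for x y
  proof -
    obtain U \<phi> where "(U, \<phi>) \<in> A" "x \<in> U" using chart_at[OF A] .
    moreover obtain V \<psi> where "(V, \<psi>) \<in> B" "y \<in> V" using chart_at[OF B] .
    ultimately show ?thesis
      unfolding prod_atlas_def by (intro bexI[of _ "(U \<times> V, map_prod \<phi> \<psi>)"]) auto
  qed
  then have "(\<Union>(U, \<phi>)\<in>prod_atlas A B. U) = UNIV"
    by (auto simp: case_prod_unfold)
  moreover have "open (U \<times> V) \<and> open (map_prod \<phi> \<psi> ` (U \<times> V)) \<and>
      homeomorphism (U \<times> V) (map_prod \<phi> \<psi> ` (U \<times> V)) (map_prod \<phi> \<psi>)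
        (inv_into (U \<times> V) (map_prod \<phi> \<psi>))"
    if U: "(U, \<phi>) \<in> A" and V: "(V, \<psi>) \<in> B" for U V \<phi> \<psi>
  proof (intro conjI)
    have hU: "homeomorphism U (\<phi> ` U) \<phi> (inv_into U \<phi>)"
      and hV: "homeomorphism V (\<psi> ` V) \<psi> (inv_into V \<psi>)"
      using A B U V by (auto simp: open_charts_def)
    have im: "map_prod \<phi> \<psi> ` (U \<times> V) = \<phi> ` U \<times> \<psi> ` V" by auto
    show "open (U \<times> V)" using chart_props(1)[OF A U] chart_props(1)[OF B V] by (rule open_Times)
    show "open (map_prod \<phi> \<psi> ` (U \<times> V))"
      unfolding im using chart_props(2)[OF A U] chart_props(2)[OF B V] by (rule open_Times)
    have inj: "inj_on (map_prod \<phi> \<psi>) (U \<times> V)"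
      using chart_props(4)[OF A U] chart_props(4)[OF B V] by (simp add: map_prod_inj_on)
    show "homeomorphism (U \<times> V) (map_prod \<phi> \<psi> ` (U \<times> V)) (map_prod \<phi> \<psi>)
        (inv_into (U \<times> V) (map_prod \<phi> \<psi>))"
    proof (rule homeomorphismI)
      have "continuous_on (U \<times> V) (\<lambda>p. (\<phi> (fst p), \<psi> (snd p)))"
        by (intro continuous_on_Pair
            continuous_on_compose2[OF chart_props(3)[OF A U]]
            continuous_on_compose2[OF chart_props(3)[OF B V]] continuous_intros) auto
      then show "continuous_on (U \<times> V) (map_prod \<phi> \<psi>)"
        by (simp add: map_prod_def case_prod_unfold)
      have "continuous_on (\<phi> ` U \<times> \<psi> ` V) (\<lambda>p. (inv_into U \<phi> (fst p), inv_into V \<psi> (snd p)))"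
        by (intro continuous_on_Pair
            continuous_on_compose2[OF homeomorphism_cont2[OF hU]]
            continuous_on_compose2[OF homeomorphism_cont2[OF hV]] continuous_intros) auto
      then show "continuous_on (map_prod \<phi> \<psi> ` (U \<times> V)) (inv_into (U \<times> V) (map_prod \<phi> \<psi>))"
        unfolding im
      proof (rule continuous_on_eq)
        fix p assume "p \<in> \<phi> ` U \<times> \<psi> ` V"
        then show "(inv_into U \<phi> (fst p), inv_into V \<psi> (snd p)) =
            inv_into (U \<times> V) (map_prod \<phi> \<psi>) p"
          using inv_into_map_prod[OF chart_props(4)[OF A U] chart_props(4)[OF B V],
              of "fst p" "snd p"] by auto
      qed
      show "inv_into (U \<times> V) (map_prod \<phi> \<psi>) ` (map_prod \<phi> \<psi> ` (U \<times> V)) \<subseteq> U \<times> V"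
        using inj by (simp only: inv_into_image_cancel)
      show "inv_into (U \<times> V) (map_prod \<phi> \<psi>) (map_prod \<phi> \<psi> x) = x" if "x \<in> U \<times> V" for x
        using inj that by (rule inv_into_f_f)
      show "map_prod \<phi> \<psi> (inv_into (U \<times> V) (map_prod \<phi> \<psi>) y) = y"
        if "y \<in> map_prod \<phi> \<psi> ` (U \<times> V)" for y
        using that by (rule f_inv_into_f)
    qed simp
  qed
  ultimately show ?thesis
    unfolding open_charts_def prod_atlas_def by auto
qed

lemma smooth_funD:
  "smooth_fun A N f \<Longrightarrow> (U, \<phi>) \<in> A \<Longrightarrow> Ck_on k (\<phi> ` (U \<inter> N)) (\<lambda>y. f (inv_into U \<phi> y))"
  by (auto simp: smooth_fun_def smooth_on_def comp_def)

lemma smooth_funI: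
  assumes "\<And>U \<phi> k. (U, \<phi>) \<in> A \<Longrightarrow> Ck_on k (\<phi> ` (U \<inter> N)) (\<lambda>y. f (inv_into U \<phi> y))"
  shows "smooth_fun A N f"
  using assms by (auto simp: smooth_fun_def smooth_on_def comp_def)

lemma smooth_fun_subset: "smooth_fun A N f \<Longrightarrow> M \<subseteq> N \<Longrightarrow> smooth_fun A M f"
  by (rule smooth_funI) (erule Ck_on_subset[OF smooth_funD], auto)

context
  fixes A :: "('a::topological_space, 'e::euclidean_space) atlas"
  assumes A: "open_charts A"
begin

lemma open_chart_image: "(U, \<phi>) \<in> A \<Longrightarrow> open N \<Longrightarrow> open (\<phi> ` (U \<inter> N))"
  using chart_props(1,5)[OF A] by (simp add: open_Int)

lemma smooth_fun_cong:
  assumes f: "smooth_fun A N f" and "open N" and eq: "\<And>x. x \<in> N \<Longrightarrow> f x = h x"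
  shows "smooth_fun A N h"
proof (rule smooth_funI)
  fix U \<phi> k assume U: "(U, \<phi>) \<in> A"
  show "Ck_on k (\<phi> ` (U \<inter> N)) (\<lambda>y. h (inv_into U \<phi> y))"
    using chart_props(6)[OF A U] eq
    by (intro Ck_on_cong[OF smooth_funD[OF f U]] open_chart_image U \<open>open N\<close>) auto
qed

lemma smooth_fun_local:
  assumes "\<And>x. x \<in> N \<Longrightarrow> \<exists>M. open M \<and> x \<in> M \<and> smooth_fun A M f"
  shows "smooth_fun A N f"
proof (intro smooth_funI Ck_on_local)
  fix U \<phi> k y assume U: "(U, \<phi>) \<in> A" and "y \<in> \<phi> ` (U \<inter> N)"
  then obtain x where x: "x \<in> U" "x \<in> N" "y = \<phi> x" by auto
  then obtain M where "open M" "x \<in> M" "smooth_fun A M f" using assms by blast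
  then show "\<exists>T. open T \<and> y \<in> T \<and> Ck_on k T (\<lambda>y. f (inv_into U \<phi> y))"
    using x U by (intro exI[of _ "\<phi> ` (U \<inter> M)"]) (auto intro: open_chart_image smooth_funD)
qed

lemma smooth_fun_const: "smooth_fun A N (\<lambda>x. c)"
  by (intro smooth_funI Ck_on_const)

lemma smooth_fun_add:
  "smooth_fun A N f \<Longrightarrow> smooth_fun A N h \<Longrightarrow> open N \<Longrightarrow> smooth_fun A N (\<lambda>x. f x + h x)"
  using open_chart_image by (intro smooth_funI Ck_on_add; simp add: smooth_funD)

lemma smooth_fun_mult:
  "smooth_fun A N f \<Longrightarrow> smooth_fun A N h \<Longrightarrow> open N \<Longrightarrow> smooth_fun A N (\<lambda>x. f x * h x)"
  unfolding real_scaleR_def[symmetric]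
  using open_chart_image by (intro smooth_funI Ck_on_scaleR; simp add: smooth_funD)

lemma smooth_fun_diff:
  assumes "smooth_fun A N f" "smooth_fun A N h" "open N"
  shows "smooth_fun A N (\<lambda>x. f x - h x)"
  using smooth_fun_add[OF assms(1) smooth_fun_mult[OF smooth_fun_const[of _ "-1"] assms(2)]] assms(3)
  by simp

lemma smooth_nearI: "smooth_fun A N f \<Longrightarrow> open N \<Longrightarrow> p \<in> N \<Longrightarrow> f \<in> smooth_near A p"
  by (auto simp: smooth_near_def)

lemma smooth_near_add:
  assumes "f \<in> smooth_near A p" "h \<in> smooth_near A p"
  shows "(\<lambda>x. f x + h x) \<in> smooth_near A p"
proof -
  obtain N M where N: "open N" "p \<in> N" "smooth_fun A N f" and M: "open M" "p \<in> M" "smooth_fun A M h"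
    using assms by (auto simp: smooth_near_def)
  then show ?thesis
    by (intro smooth_nearI[of "N \<inter> M"] smooth_fun_add smooth_fun_subset[OF N(3)]
        smooth_fun_subset[OF M(3)]) auto
qed

lemma smooth_near_mult:
  assumes "f \<in> smooth_near A p" "h \<in> smooth_near A p"
  shows "(\<lambda>x. f x * h x) \<in> smooth_near A p"
proof -
  obtain N M where N: "open N" "p \<in> N" "smooth_fun A N f" and M: "open M" "p \<in> M" "smooth_fun A M h"
    using assms by (auto simp: smooth_near_def)
  then show ?thesis
    by (intro smooth_nearI[of "N \<inter> M"] smooth_fun_mult smooth_fun_subset[OF N(3)]
        smooth_fun_subset[OF M(3)]) auto
qed

lemma smooth_near_const: "(\<lambda>x. c) \<in> smooth_near A p"
  using smooth_nearI[OF smooth_fun_const open_UNIV] by simp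

text \<open>The indicator of \<open>N\<close> takes the place of a bump function, since
  \<open>smooth_near\<close> looks only at a neighbourhood of \<open>p\<close>. It is idempotent
  with value 1 at \<open>p\<close>, so the Leibniz rule gives \<open>v \<eta> = 0\<close>;
  multiplying by it makes \<open>f\<close> and \<open>h\<close> equal everywhere without changing
  the derivative at \<open>p\<close>.\<close>

lemma tangent_space_local:
  assumes v: "v \<in> tangent_space A p" and f: "f \<in> smooth_near A p"
    and N: "open N" "p \<in> N" and eq: "\<And>x. x \<in> N \<Longrightarrow> f x = h x"
  shows "v f = v h"
proof -
  define \<eta> :: "'a \<Rightarrow> real" where "\<eta> = indicator N"
  have \<eta>: "\<eta> \<in> smooth_near A p"
    using N by (intro smooth_nearI[of N] smooth_fun_cong[OF smooth_fun_const[of _ 1]])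
      (auto simp: \<eta>_def)
  obtain M where M: "open M" "p \<in> M" "smooth_fun A M f" using f by (auto simp: smooth_near_def)
  have h: "h \<in> smooth_near A p"
    using M N eq by (intro smooth_nearI[of "M \<inter> N"]
        smooth_fun_cong[OF smooth_fun_subset[OF M(3)]]) auto
  have leib: "v (\<lambda>x. u x * w x) = v u * w p + u p * v w"
    if "u \<in> smooth_near A p" "w \<in> smooth_near A p" for u w
    using v that by (simp add: tangent_space_def)
  have "(\<lambda>x. \<eta> x * \<eta> x) = \<eta>" by (auto simp: \<eta>_def indicator_def)
  then have "v \<eta> = 0" using leib[OF \<eta> \<eta>] N by (simp add: \<eta>_def)
  then have "v (\<lambda>x. f x * \<eta> x) = v f" "v (\<lambda>x. h x * \<eta> x) = v h"
    using leib[OF f \<eta>] leib[OF h \<eta>] N by (simp_all add: \<eta>_def)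
  moreover have "(\<lambda>x. f x * \<eta> x) = (\<lambda>x. h x * \<eta> x)"
    using eq by (auto simp: \<eta>_def indicator_def)
  ultimately show ?thesis by simp
qed

end

section \<open>Pullback along smooth maps, slices of products, and pushforward\<close>

lemma smooth_fun_pullback:
  assumes A: "open_charts A" and B: "open_charts B"
    and f: "smooth_map A B W f" and h: "smooth_fun B W' h" and "open W" "open W'"
  shows "smooth_fun A (W \<inter> f -` W') (h \<circ> f)"
proof (intro smooth_funI Ck_on_local)
  fix U \<phi> k y assume U: "(U, \<phi>) \<in> A" and "y \<in> \<phi> ` (U \<inter> (W \<inter> f -` W'))"
  then obtain x where x: "x \<in> U" "x \<in> W" "f x \<in> W'" "y = \<phi> x" by auto
  obtain V \<psi> where V: "(V, \<psi>) \<in> B" "f x \<in> V" using chart_at[OF B] .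
  note VB = chart_props[OF B V(1)] and UA = chart_props[OF A U]
  have cont: "continuous_on W f" using f by (simp add: smooth_map_def)
  have op: "open (W \<inter> f -` (V \<inter> W'))"
    using continuous_open_preimage[OF cont \<open>open W\<close>, of "V \<inter> W'"] VB(1) \<open>open W'\<close> by auto
  \<comment> \<open>\<open>smooth_map\<close> controls \<open>f\<close> only where it sends one
    chart into one chart, so \<open>h \<circ> f\<close> is factored through \<open>\<psi>\<close> on
    this neighbourhood; \<open>Ck_on_local\<close> joins the pieces.\<close>
  define T where "T = \<phi> ` (U \<inter> (W \<inter> f -` (V \<inter> W')))"
  have T: "open T" unfolding T_def using open_chart_image[OF A U op] .
  have "smooth_on (\<phi> ` (U \<inter> W \<inter> f -` V)) (\<psi> \<circ> f \<circ> inv_into U \<phi>)"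
    using f U V by (auto simp: smooth_map_def)
  then have "Ck_on k (\<phi> ` (U \<inter> W \<inter> f -` V)) (\<lambda>y. \<psi> (f (inv_into U \<phi> y)))"
    by (simp add: smooth_on_def comp_def)
  then have sf: "Ck_on k T (\<lambda>y. \<psi> (f (inv_into U \<phi> y)))"
    by (rule Ck_on_subset) (auto simp: T_def)
  have "Ck_on k T (\<lambda>y. h (inv_into V \<psi> (\<psi> (f (inv_into U \<phi> y)))))"
    by (rule Ck_on_comp[OF T open_chart_image[OF B V(1) \<open>open W'\<close>] _ smooth_funD[OF h V(1)] sf])
      (auto simp: T_def UA(6))
  then have "Ck_on k T (\<lambda>y. (h \<circ> f) (inv_into U \<phi> y))"
    by (rule Ck_on_cong[OF _ T]) (auto simp: T_def UA(6) VB(6))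
  then show "\<exists>T. open T \<and> y \<in> T \<and> Ck_on k T (\<lambda>y. (h \<circ> f) (inv_into U \<phi> y))"
    using T x V by (intro exI[of _ T]) (auto simp: T_def)
qed

text \<open>In product charts freezing a point is the affine inclusion
  \<open>y \<mapsto> (y, \<psi> c)\<close>. This extracts one-variable smoothness from the jointly
  smooth action and from local trivializations.\<close>

lemma smooth_fun_slice1:
  assumes A: "open_charts A" and B: "open_charts B"
    and H: "smooth_fun (prod_atlas A B) N H" and N: "open N"
  shows "smooth_fun A {x. (x, c) \<in> N} (\<lambda>x. H (x, c))"
proof (rule smooth_funI)
  fix U \<phi> k assume U: "(U, \<phi>) \<in> A"
  obtain V \<psi> where V: "(V, \<psi>) \<in> B" "c \<in> V" using chart_at[OF B] .
  note UA = chart_props[OF A U] and VB = chart_props[OF B V(1)]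
  have UV: "(U \<times> V, map_prod \<phi> \<psi>) \<in> prod_atlas A B"
    using U V by (auto simp: prod_atlas_def)
  have "open ((\<lambda>x. (x, c)) -` N)"
    by (intro open_vimage N continuous_intros)
  then have T: "open (\<phi> ` (U \<inter> {x. (x, c) \<in> N}))"
    using open_chart_image[OF A U] by (simp add: vimage_def)
  have aff: "Ck_on k (\<phi> ` (U \<inter> {x. (x, c) \<in> N})) (\<lambda>y. (y, \<psi> c))"
  proof -
    have "Ck_on k (\<phi> ` (U \<inter> {x. (x, c) \<in> N})) (\<lambda>y. (y, 0) + (0, \<psi> c))"
      by (intro Ck_on_add T Ck_on_const Ck_on_bounded_linear
          bounded_linear_Pair bounded_linear_ident bounded_linear_zero)
    then show ?thesis by simp
  qed
  have "Ck_on k (\<phi> ` (U \<inter> {x. (x, c) \<in> N}))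
      (\<lambda>y. H (inv_into (U \<times> V) (map_prod \<phi> \<psi>) (y, \<psi> c)))"
    by (rule Ck_on_comp[OF T open_chart_image[OF open_charts_prod_atlas[OF A B] UV N] _
          smooth_funD[OF H UV] aff]) (use V in auto)
  then show "Ck_on k (\<phi> ` (U \<inter> {x. (x, c) \<in> N})) (\<lambda>y. H (inv_into U \<phi> y, c))"
    by (rule Ck_on_cong[OF _ T])
      (use V in \<open>auto simp: inv_into_map_prod[OF UA(4) VB(4)] UA(6) VB(6)\<close>)
qed

lemma smooth_fun_slice2:
  assumes A: "open_charts A" and B: "open_charts B"
    and H: "smooth_fun (prod_atlas A B) N H" and N: "open N"
  shows "smooth_fun B {y. (c, y) \<in> N} (\<lambda>y. H (c, y))"
proof (rule smooth_funI)
  fix V \<psi> k assume V: "(V, \<psi>) \<in> B"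
  obtain U \<phi> where U: "(U, \<phi>) \<in> A" "c \<in> U" using chart_at[OF A] .
  note UA = chart_props[OF A U(1)] and VB = chart_props[OF B V]
  have UV: "(U \<times> V, map_prod \<phi> \<psi>) \<in> prod_atlas A B"
    using U V by (auto simp: prod_atlas_def)
  have "open ((\<lambda>y. (c, y)) -` N)"
    by (intro open_vimage N continuous_intros)
  then have T: "open (\<psi> ` (V \<inter> {y. (c, y) \<in> N}))"
    using open_chart_image[OF B V] by (simp add: vimage_def)
  have aff: "Ck_on k (\<psi> ` (V \<inter> {y. (c, y) \<in> N})) (\<lambda>y. (\<phi> c, y))"
  proof -
    have "Ck_on k (\<psi> ` (V \<inter> {y. (c, y) \<in> N})) (\<lambda>y. (0, y) + (\<phi> c, 0))"
      by (intro Ck_on_add T Ck_on_const Ck_on_bounded_linear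
          bounded_linear_Pair bounded_linear_ident bounded_linear_zero)
    then show ?thesis by simp
  qed
  have "Ck_on k (\<psi> ` (V \<inter> {y. (c, y) \<in> N}))
      (\<lambda>y. H (inv_into (U \<times> V) (map_prod \<phi> \<psi>) (\<phi> c, y)))"
    by (rule Ck_on_comp[OF T open_chart_image[OF open_charts_prod_atlas[OF A B] UV N] _
          smooth_funD[OF H UV] aff]) (use U in auto)
  then show "Ck_on k (\<psi> ` (V \<inter> {y. (c, y) \<in> N})) (\<lambda>y. H (c, inv_into V \<psi> y))"
    by (rule Ck_on_cong[OF _ T])
      (use U in \<open>auto simp: inv_into_map_prod[OF UA(4) VB(4)] UA(6) VB(6)\<close>)
qed

lemma smooth_near_pullback:
  assumes "open_charts A" "open_charts B" "smooth_map A B UNIV f" "h \<in> smooth_near B (f p)"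
  shows "h \<circ> f \<in> smooth_near A p"
proof -
  obtain N where N: "open N" "f p \<in> N" "smooth_fun B N h"
    using assms(4) by (auto simp: smooth_near_def)
  have "open (f -` N)"
    using assms(3) N(1) open_vimage by (auto simp: smooth_map_def)
  then show ?thesis
    using smooth_fun_pullback[OF assms(1-3) N(3)] N
    by (intro smooth_nearI[OF assms(1), of "f -` N"]) auto
qed

text \<open>Pulling back respects sums and products, so derivations go to derivations once pulled
  back test functions are smooth near \<open>p\<close>. The hypothesis is put on test functions
  because that is the form in which the orbit maps of the action are controlled.\<close>

lemma pushforward_tangent:
  assumes B: "open_charts B"
    and pb: "\<And>f. f \<in> smooth_near B (\<Psi> p) \<Longrightarrow> f \<circ> \<Psi> \<in> smooth_near A p"
    and v: "v \<in> tangent_space A p"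
  shows "pushforward B \<Psi> p v \<in> tangent_space B (\<Psi> p)"
proof -
  have const_mult: "(\<lambda>x. c * f x) \<in> smooth_near B (\<Psi> p)" if "f \<in> smooth_near B (\<Psi> p)" for f c
    using smooth_near_mult[OF B smooth_near_const[OF B] that] .
  show ?thesis
    using v pb unfolding tangent_space_def pushforward_def
    by (auto simp: smooth_near_add[OF B] smooth_near_mult[OF B] const_mult comp_def)
qed

section \<open>Symmetric tensors, brackets and chart coordinates\<close>

lemma tensor_commute:
  "sym_tensor A t \<Longrightarrow> u \<in> tangent_space A p \<Longrightarrow> v \<in> tangent_space A p \<Longrightarrow> t p u v = t p v u"
  by (simp add: sym_tensor_def)

lemma tensor_add_left:
  assumes "sym_tensor A t" "u \<in> tangent_space A p" "v \<in> tangent_space A p" "w \<in> tangent_space A p"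
  shows "t p (u + v) w = t p u w + t p v w"
  using assms unfolding sym_tensor_def by blast

lemma tensor_scaleR_left:
  assumes "sym_tensor A t" "u \<in> tangent_space A p" "w \<in> tangent_space A p"
  shows "t p (c *\<^sub>R u) w = c * t p u w"
  using assms unfolding sym_tensor_def by blast

lemma tangent_space_sum:
  "(\<And>i. i \<in> I \<Longrightarrow> u i \<in> tangent_space A p) \<Longrightarrow> (\<Sum>i\<in>I. c i *\<^sub>R u i) \<in> tangent_space A p"
  by (intro subspace_sum subspace_scale subspace_tangent_space)

lemma tensor_sum_left:
  assumes t: "sym_tensor A t" and w: "w \<in> tangent_space A p"
    and "finite I" and "\<And>i. i \<in> I \<Longrightarrow> u i \<in> tangent_space A p"
  shows "t p (\<Sum>i\<in>I. c i *\<^sub>R u i) w = (\<Sum>i\<in>I. c i * t p (u i) w)"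
  using assms(3,4)
proof (induction I rule: finite_induct)
  case empty
  have "0 \<in> tangent_space A p" using subspace_0[OF subspace_tangent_space] .
  from tensor_scaleR_left[OF t this w, of 0] show ?case by (simp only: scale_zero_left sum.empty mult_zero_left)
next
  case (insert i I)
  have S: "(\<Sum>i\<in>I. c i *\<^sub>R u i) \<in> tangent_space A p"
    using insert by (intro tangent_space_sum) auto
  have u: "u i \<in> tangent_space A p" using insert by simp
  have IH: "t p (\<Sum>i\<in>I. c i *\<^sub>R u i) w = (\<Sum>i\<in>I. c i * t p (u i) w)"
    by (rule insert.IH) (rule insert.prems, rule insertI2)
  show ?case
    unfolding sum.insert[OF insert.hyps]
      tensor_add_left[OF t subspace_scale[OF subspace_tangent_space u] S w]
      tensor_scaleR_left[OF t u w] IH ..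
qed

lemma sum_fun_apply: "(\<Sum>i\<in>I. f i) x = (\<Sum>i\<in>I. f i x)"
  for f :: "'i \<Rightarrow> 'a \<Rightarrow> 'b::comm_monoid_add"
  by (induction I rule: infinite_finite_induct) auto

text \<open>Tangency is read off later from the expansion of the bracket in the frame. What remains
  is dependence on the point: both terms differentiate a smooth function twice along smooth fields,
  and the guard in \<open>lie_bracket\<close> is met throughout \<open>N\<close> because
  \<open>f\<close> is smooth there.\<close>

lemma lie_bracket_smooth_vfield:
  assumes A: "open_charts A" and X: "smooth_vfield A W X" and Y: "smooth_vfield A W Y"
    and T: "\<And>p. p \<in> W \<Longrightarrow> lie_bracket A X Y p \<in> tangent_space A p"
  shows "smooth_vfield A W (lie_bracket A X Y)"
  unfolding smooth_vfield_def
proof (intro conjI ballI allI impI)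
  fix N f assume N: "open N \<and> N \<subseteq> W \<and> smooth_fun A N f"
  have sm: "smooth_fun A N (\<lambda>p. Z p f)" if "smooth_vfield A W Z" "smooth_fun A N f" for Z f
    using that N by (simp add: smooth_vfield_def)
  have "smooth_fun A N (\<lambda>p. X p (\<lambda>x. Y x f) - Y p (\<lambda>x. X x f))"
    by (rule smooth_fun_diff[OF A sm[OF X sm[OF Y]] sm[OF Y sm[OF X]]]) (use N in auto)
  then show "smooth_fun A N (\<lambda>p. lie_bracket A X Y p f)"
    by (rule smooth_fun_cong[OF A])
      (use N smooth_nearI[OF A, of N f] in \<open>auto simp: lie_bracket_def\<close>)
qed (use T in auto)

text \<open>Read in another chart \<open>\<psi>\<close>, the coordinates \<open>\<kappa>\<close> are
  a transition map; this is where smoothness of transition maps enters. The components serve as test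
  functions dual to the coordinate fields.\<close>

lemma chart_component_smooth:
  fixes A :: "('a::{t2_space,second_countable_topology}, real^'m) atlas"
  assumes A: "manifold A" and U: "(U, \<kappa>) \<in> A"
  shows "smooth_fun A U (\<lambda>x. \<kappa> x $ b)"
proof (rule smooth_funI)
  fix V \<psi> k assume V: "(V, \<psi>) \<in> A"
  have "\<forall>(V, \<psi>)\<in>A. \<forall>(U, \<kappa>)\<in>A. smooth_on (\<psi> ` (V \<inter> U)) (\<kappa> \<circ> inv_into V \<psi>)"
    using A unfolding manifold_def by blast
  then have "smooth_on (\<psi> ` (V \<inter> U)) (\<kappa> \<circ> inv_into V \<psi>)" using U V by blast
  then have "Ck_on k (\<psi> ` (V \<inter> U)) (\<lambda>y. \<kappa> (inv_into V \<psi> y))"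
    by (simp add: smooth_on_def comp_def)
  moreover have "open (\<psi> ` (V \<inter> U))"
    using open_chart_image[OF manifold_open_charts[OF A] V]
      chart_props(1)[OF manifold_open_charts[OF A] U] .
  ultimately show "Ck_on k (\<psi> ` (V \<inter> U)) (\<lambda>y. \<kappa> (inv_into V \<psi> y) $ b)"
    by (rule Ck_on_linear_comp[OF bounded_linear_vec_nth])
qed

lemma coord_field_component:
  fixes A :: "('a::{t2_space,second_countable_topology}, real^'m) atlas"
  assumes A: "manifold A" and U: "(U, \<kappa>) \<in> A" and x: "x \<in> U"
  shows "coord_field A U \<kappa> a x (\<lambda>x. \<kappa> x $ b) = (if a = b then 1 else 0)"
proof -
  note oc = manifold_open_charts[OF A]
  note ch = chart_props[OF oc U]
  have "(\<lambda>x. \<kappa> x $ b) \<in> smooth_near A x"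
    using smooth_nearI[OF oc chart_component_smooth[OF A U] ch(1) x] .
  moreover have "frechet_derivative ((\<lambda>x. \<kappa> x $ b) \<circ> inv_into U \<kappa>) (at (\<kappa> x)) = (\<lambda>v. v $ b)"
  proof -
    have D: "((\<lambda>v. v $ b) has_derivative (\<lambda>v. v $ b)) (at (\<kappa> x))"
      by (intro bounded_linear_imp_has_derivative bounded_linear_vec_nth)
    have "frechet_derivative ((\<lambda>x. \<kappa> x $ b) \<circ> inv_into U \<kappa>) (at (\<kappa> x)) =
        frechet_derivative (\<lambda>v. v $ b) (at (\<kappa> x))"
    proof (rule frechet_derivative_cong_open(2)[OF ch(2)])
      show "(\<lambda>v. v $ b) differentiable at (\<kappa> x)" using D by (rule differentiableI)
    qed (use x in \<open>auto simp: f_inv_into_f\<close>)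
    then show ?thesis using frechet_derivative_at[OF D] by simp
  qed
  ultimately show ?thesis
    by (simp add: coord_field_def axis_def)
qed


section \<open>The curvature term of an adapted frame\<close>

text \<open>\<open>matrix_inv\<close> is a choice and an actual inverse only for an invertible
  matrix, which positive definiteness has to provide. A kernel vector \<open>x\<close> of the Gram
  matrix gives a combination \<open>u\<close> of the \<open>X b q\<close> orthogonal to each of
  them; so g(u, u) = 0, \<open>u = 0\<close>, and \<open>x = 0\<close> by independence.\<close>

lemma gram_left_inverse:
  fixes X :: "'m::finite \<Rightarrow> 'q::topological_space vfield"
  assumes g: "riemannian_metric A g" and X: "\<And>a. X a q \<in> tangent_space A q"
    and indep: "\<forall>c. (\<Sum>a\<in>UNIV. c a *\<^sub>R X a q) = 0 \<longrightarrow> (\<forall>b. c b = 0)"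
  shows "(\<Sum>d\<in>UNIV. matrix_inv (gram g X q) $ a $ d * g q (X d q) (X b q)) = (if a = b then 1 else 0)"
proof -
  have sym: "sym_tensor A g" using g by (simp add: riemannian_metric_def)
  have "x = 0" if x: "gram g X q *v x = 0" for x
  proof -
    define u where "u = (\<Sum>b\<in>UNIV. x $ b *\<^sub>R X b q)"
    have u: "u \<in> tangent_space A q" unfolding u_def using X by (rule tangent_space_sum)
    have "g q (X a q) u = 0" for a
    proof -
      have "g q (X a q) u = g q u (X a q)" using tensor_commute[OF sym X u] .
      also have "\<dots> = (\<Sum>b\<in>UNIV. x $ b * g q (X b q) (X a q))"
        unfolding u_def using tensor_sum_left[OF sym X finite X] .
      also have "\<dots> = (gram g X q *v x) $ a"
        using tensor_commute[OF sym X X]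
        by (simp add: gram_def matrix_vector_mult_def mult.commute)
      finally show ?thesis using x by simp
    qed
    then have "g q u u = 0"
      using tensor_sum_left[where I = UNIV and c = "\<lambda>b. x $ b" and u = "\<lambda>b. X b q",
          OF sym u finite X] by (simp only: u_def[symmetric]) simp
    then have "u = 0" using g u unfolding riemannian_metric_def by fastforce
    then show "x = 0" using indep[rule_format, of "\<lambda>b. x $ b"] by (simp only: u_def vec_eq_iff zero_index) simp
  qed
  then have "invertible (gram g X q)"
    by (simp add: invertible_left_inverse matrix_left_invertible_ker)
  then have "matrix_inv (gram g X q) ** gram g X q = mat 1"
    unfolding invertible_def matrix_inv_def by (rule someI2_ex) simp
  then have "(matrix_inv (gram g X q) ** gram g X q) $ a $ b = mat 1 $ a $ b" by simp
  then show ?thesis by (simp add: matrix_matrix_mult_def mat_def gram_def)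
qed

text \<open>The correction with coefficients \<open>K_coeff\<close> is minus the g-orthogonal
  projection of \<open>V i q\<close> to the span of the \<open>X b q\<close>.\<close>

lemma adapted_frame_orthogonal:
  fixes X :: "'m::finite \<Rightarrow> 'q::topological_space vfield"
  assumes g: "riemannian_metric A g" and X: "\<And>a. X a q \<in> tangent_space A q"
    and indep: "\<forall>c. (\<Sum>a\<in>UNIV. c a *\<^sub>R X a q) = 0 \<longrightarrow> (\<forall>b. c b = 0)"
    and V: "V i q \<in> tangent_space A q"
  shows "g q (adapted_frame g X V (Inr i) q) (X b q) = 0"
proof -
  have sym: "sym_tensor A g" using g by (simp add: riemannian_metric_def)
  define M where "M = matrix_inv (gram g X q)"
  have inv: "(\<Sum>d\<in>UNIV. M $ a $ d * g q (X d q) (X b q)) = (if a = b then 1 else 0)" for a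
    unfolding M_def by (rule gram_left_inverse[where X = X and q = q, OF g X indep])
  have "g q (\<Sum>d\<in>UNIV. K_coeff g X V d i q *\<^sub>R X d q) (X b q) =
      (\<Sum>d\<in>UNIV. K_coeff g X V d i q * g q (X d q) (X b q))"
    by (rule tensor_sum_left[OF sym X finite X])
  also have "\<dots> = - (\<Sum>d\<in>UNIV. \<Sum>a\<in>UNIV. M $ a $ d * g q (X d q) (X b q) * g q (X a q) (V i q))"
    by (simp add: K_coeff_def M_def sum_distrib_left sum_distrib_right sum_negf mult_ac)
  \<comment> \<open>Exchanging the sums brings a row of \<open>M\<close> against a column of the
    Gram matrix, which is a Kronecker delta.\<close>
  also have "\<dots> = - (\<Sum>a\<in>UNIV. (\<Sum>d\<in>UNIV. M $ a $ d * g q (X d q) (X b q)) * g q (X a q) (V i q))"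
    by (subst sum.swap) (simp add: sum_distrib_right)
  also have "\<dots> = - g q (X b q) (V i q)"
    by (simp add: inv if_distrib[of "\<lambda>x. x * _"] cong: if_cong)
  finally have "g q (\<Sum>d\<in>UNIV. K_coeff g X V d i q *\<^sub>R X d q) (X b q) = - g q (X b q) (V i q)" .
  moreover have "g q (adapted_frame g X V (Inr i) q) (X b q) =
      g q (V i q) (X b q) + g q (\<Sum>d\<in>UNIV. K_coeff g X V d i q *\<^sub>R X d q) (X b q)"
    unfolding adapted_frame_def sum.case
    by (rule tensor_add_left[OF sym V tangent_space_sum[OF X] X])
  ultimately show ?thesis using tensor_commute[OF sym V X] by simp
qed

text \<open>Both tensors are evaluated on one and the same expansion of the bracket, so the
  coefficients with upper index \<open>Inl d\<close> drop out of the difference. The identity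
  therefore holds for whatever family \<open>R\<close> realizes the expansion, and the expansion
  also shows that the bracket is tangent.\<close>

lemma curvature_term_eq:
  fixes X :: "'m::finite \<Rightarrow> 'q::topological_space vfield"
    and V :: "'k::finite \<Rightarrow> 'q vfield"
  assumes g: "riemannian_metric A g" and g': "D_preserving_modification A D g g'"
    and X: "\<And>a. X a q \<in> tangent_space A q" and XD: "\<And>a. X a q \<in> D q"
    and indep: "\<forall>c. (\<Sum>a\<in>UNIV. c a *\<^sub>R X a q) = 0 \<longrightarrow> (\<forall>b. c b = 0)"
    and V: "\<And>i. V i q \<in> tangent_space A q"
    and R: "structure_functions A W (adapted_frame g X V) R" and q: "q \<in> W"
  shows "lie_bracket A (X a) (X c) q \<in> tangent_space A q"
    "curvature_term g' (adapted_frame g X V) R b a c q =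
      g' q (X b q) (lie_bracket A (X a) (X c) q) - g q (X b q) (lie_bracket A (X a) (X c) q)"
proof -
  define E where "E = adapted_frame g X V"
  define r where "r \<gamma> = R \<gamma> (Inl a) (Inl c) q" for \<gamma>
  have EX: "E (Inl d) = X d" for d by (simp add: E_def adapted_frame_def fun_eq_iff)
  have E: "E \<gamma> q \<in> tangent_space A q" for \<gamma>
    unfolding E_def adapted_frame_def
    by (cases \<gamma>) (auto intro!: X V tangent_space_sum subspace_add subspace_tangent_space
        simp del: scaleR_fun_apply)
  have br: "lie_bracket A (X a) (X c) q = (\<Sum>\<gamma>\<in>UNIV. r \<gamma> *\<^sub>R E \<gamma> q)"
    using R q unfolding structure_functions_def E_def[symmetric] r_def EX[symmetric] by blast
  show T: "lie_bracket A (X a) (X c) q \<in> tangent_space A q"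
    unfolding br using E by (rule tangent_space_sum)
  have expand: "t q (X b q) (lie_bracket A (X a) (X c) q) =
      (\<Sum>d\<in>UNIV. r (Inl d) * t q (X d q) (X b q)) + (\<Sum>k\<in>UNIV. r (Inr k) * t q (E (Inr k) q) (X b q))"
    if t: "sym_tensor A t" for t
  proof -
    have "t q (X b q) (lie_bracket A (X a) (X c) q) = t q (lie_bracket A (X a) (X c) q) (X b q)"
      using tensor_commute[OF t X T] .
    also have "\<dots> = (\<Sum>\<gamma>\<in>UNIV. r \<gamma> * t q (E \<gamma> q) (X b q))"
      unfolding br using tensor_sum_left[OF t X finite E] .
    also have "\<dots> = (\<Sum>d\<in>UNIV. r (Inl d) * t q (X d q) (X b q)) +
        (\<Sum>k\<in>UNIV. r (Inr k) * t q (E (Inr k) q) (X b q))"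
      unfolding UNIV_Plus_UNIV[symmetric] by (subst sum.Plus) (simp_all add: EX)
    finally show ?thesis .
  qed
  have sym: "sym_tensor A g" "sym_tensor A g'"
    and eq: "g' q (X d q) (X b q) = g q (X d q) (X b q)" for d
    using g g' XD by (simp_all add: riemannian_metric_def D_preserving_modification_def)
  have "g q (E (Inr k) q) (X b q) = 0" for k
    unfolding E_def by (rule adapted_frame_orthogonal[where X = X and V = V and q = q, OF g X indep V])
  then have "g' q (X b q) (lie_bracket A (X a) (X c) q) - g q (X b q) (lie_bracket A (X a) (X c) q) =
      (\<Sum>k\<in>UNIV. r (Inr k) * g' q (E (Inr k) q) (X b q))"
    by (simp add: expand[OF sym(1)] expand[OF sym(2)] eq)
  also have "\<dots> = curvature_term g' E R b a c q"
    unfolding curvature_term_def EX r_def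
    using tensor_commute[OF sym(2) E X] by (simp add: mult.commute)
  finally show "curvature_term g' (adapted_frame g X V) R b a c q =
      g' q (X b q) (lie_bracket A (X a) (X c) q) - g q (X b q) (lie_bracket A (X a) (X c) q)"
    by (simp add: E_def)
qed


section \<open>Invariance and descent in a Chaplygin system\<close>

context
  fixes AQ :: "('q::{t2_space,second_countable_topology}, real^'n::finite) atlas"
    and AB :: "('b::{t2_space,second_countable_topology}, real^'m::finite) atlas"
    and AG :: "('g::{t2_space,second_countable_topology}, real^'k::finite) atlas"
    and G :: "'g monoid"
    and \<Phi> :: "'g \<Rightarrow> 'q \<Rightarrow> 'q"
    and \<pi> :: "'q \<Rightarrow> 'b"
    and g :: "'q tensor2"
    and D :: "'q \<Rightarrow> 'q tvec set"
  assumes system: "chaplygin_system AQ AB AG G \<Phi> \<pi> g D"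
begin

section \<open>Projection and group action as operations on functions\<close>

lemma chaplygin_charts: "open_charts AQ" "open_charts AB" "open_charts AG"
  using system by (auto simp: chaplygin_system_def lie_group_def intro: manifold_open_charts)

lemma chaplygin_bundle: "principal_bundle AQ AB AG G \<Phi> \<pi>"
  using system by (simp add: chaplygin_system_def)

lemma projection_smooth: "smooth_map AQ AB UNIV \<pi>" and projection_surj: "surj \<pi>"
  using chaplygin_bundle by (simp_all add: principal_bundle_def)

lemma open_projection_vimage: "open U \<Longrightarrow> open (\<pi> -` U)"
  using projection_smooth open_vimage by (auto simp: smooth_map_def)

lemma chaplygin_action: "group_action G UNIV \<Phi>" "carrier G = UNIV"
  using system by (simp_all add: chaplygin_system_def free_proper_action_def lie_group_def)

lemma action_one: "\<Phi> \<one>\<^bsub>G\<^esub> q = q"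
  using group_action.id_eq_one[OF chaplygin_action(1)] by (metis UNIV_I restrict_apply')

lemma projection_eq_iff: "\<pi> q = \<pi> q' \<longleftrightarrow> (\<exists>h. q' = \<Phi> h q)"
proof -
  have "\<pi> q = \<pi> q' \<longleftrightarrow> orbit G \<Phi> q = orbit G \<Phi> q'"
    using chaplygin_bundle by (simp add: principal_bundle_def)
  also have "\<dots> \<longleftrightarrow> q' \<in> orbit G \<Phi> q"
    using group_action.orbit_refl[OF chaplygin_action(1)]
      group_action.orbit_sym[OF chaplygin_action(1)] group_action.orbit_trans[OF chaplygin_action(1)]
    by blast
  finally show ?thesis by (simp add: orbit_def chaplygin_action(2))
qed

lemma projection_action [simp]: "\<pi> (\<Phi> h q) = \<pi> q"
  using projection_eq_iff by metis

lemma smooth_fun_action_map: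
  assumes "smooth_fun AQ N f" "open N"
  shows "open ((\<lambda>(h, q). \<Phi> h q) -` N)"
    "smooth_fun (prod_atlas AG AQ) ((\<lambda>(h, q). \<Phi> h q) -` N) (\<lambda>(h, q). f (\<Phi> h q))"
proof -
  have sm: "smooth_map (prod_atlas AG AQ) AQ UNIV (\<lambda>(h, q). \<Phi> h q)"
    using system by (simp add: chaplygin_system_def free_proper_action_def)
  then show "open ((\<lambda>(h, q). \<Phi> h q) -` N)"
    using assms(2) open_vimage by (auto simp: smooth_map_def)
  show "smooth_fun (prod_atlas AG AQ) ((\<lambda>(h, q). \<Phi> h q) -` N) (\<lambda>(h, q). f (\<Phi> h q))"
    using smooth_fun_pullback[OF open_charts_prod_atlas[OF chaplygin_charts(3,1)]
        chaplygin_charts(1) sm assms(1) open_UNIV assms(2)]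
    by (simp add: comp_def case_prod_unfold)
qed

text \<open>Translations and orbit maps are slices of the jointly smooth action. Only their effect
  on test functions is extracted, which is what \<open>pushforward\<close> asks for.\<close>

lemma action_near:
  assumes "f \<in> smooth_near AQ (\<Phi> h q)"
  shows "f \<circ> \<Phi> h \<in> smooth_near AQ q" "f \<circ> (\<lambda>h. \<Phi> h q) \<in> smooth_near AG h"
proof -
  obtain N where N: "open N" "\<Phi> h q \<in> N" "smooth_fun AQ N f"
    using assms by (auto simp: smooth_near_def)
  note op = smooth_fun_action_map(1)[OF N(3,1)] and sm = smooth_fun_action_map(2)[OF N(3,1)]
  have "open ((\<lambda>q. (h, q)) -` ((\<lambda>(h, q). \<Phi> h q) -` N))"
    "open ((\<lambda>h. (h, q)) -` ((\<lambda>(h, q). \<Phi> h q) -` N))"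
    by (intro open_vimage[OF op] continuous_intros)+
  then show "f \<circ> \<Phi> h \<in> smooth_near AQ q" "f \<circ> (\<lambda>h. \<Phi> h q) \<in> smooth_near AG h"
    using smooth_fun_slice2[OF chaplygin_charts(3,1) sm op, of h]
      smooth_fun_slice1[OF chaplygin_charts(3,1) sm op, of q] N(2)
    by (auto simp: comp_def vimage_def intro: smooth_nearI[OF chaplygin_charts(1)]
        smooth_nearI[OF chaplygin_charts(3)])
qed

lemma open_action_vimage:
  assumes "open N"
  shows "open (\<Phi> h -` N)"
proof -
  have "open ((\<lambda>q. (h, q)) -` ((\<lambda>(h, q). \<Phi> h q) -` N))"
    by (rule open_vimage[OF smooth_fun_action_map(1)[OF smooth_fun_const[OF chaplygin_charts(1)] assms]])
      (intro continuous_intros)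
  then show ?thesis by (simp add: vimage_def)
qed

text \<open>Locally the descended function is the composition with a section of the bundle, obtained by
  fixing the group component in a local trivialization.\<close>

lemma invariant_fun_descends:
  assumes U: "open U" and H: "smooth_fun AQ (\<pi> -` U) H" and inv: "invariant_fun_on \<Phi> (\<pi> -` U) H"
  shows "\<exists>f. smooth_fun AB U f \<and> (\<forall>q\<in>\<pi> -` U. H q = f (\<pi> q))"
proof -
  \<comment> \<open>\<open>inv_into UNIV \<pi>\<close> is an arbitrary section, possibly
    discontinuous. Invariance of \<open>H\<close> makes \<open>f\<close> independent of it, so
    \<open>f\<close> may be compared with a smooth local section near each point.\<close>
  define f where "f x = H (inv_into UNIV \<pi> x)" for x
  have f: "H q = f (\<pi> q)" if "q \<in> \<pi> -` U" for q
  proof -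
    have "\<pi> q = \<pi> (inv_into UNIV \<pi> (\<pi> q))" by (simp add: f_inv_into_f)
    then obtain h where "inv_into UNIV \<pi> (\<pi> q) = \<Phi> h q" using projection_eq_iff by metis
    then show ?thesis using inv that by (simp add: f_def invariant_fun_on_def)
  qed
  have "smooth_fun AB U f"
  proof (rule smooth_fun_local[OF chaplygin_charts(2)])
    fix x assume x: "x \<in> U"
    obtain N \<tau> where N: "open N" "x \<in> N"
      and diff: "diffeomorphism AQ (prod_atlas AB AG) (\<pi> -` N) (N \<times> UNIV) (\<lambda>q. (\<pi> q, \<tau> q))"
      using chaplygin_bundle unfolding principal_bundle_def by blast
    define \<sigma> where "\<sigma> = inv_into (\<pi> -` N) (\<lambda>q. (\<pi> q, \<tau> q))"
    have bij: "bij_betw (\<lambda>q. (\<pi> q, \<tau> q)) (\<pi> -` N) (N \<times> UNIV)"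
      and sm: "smooth_map (prod_atlas AB AG) AQ (N \<times> UNIV) \<sigma>"
      using diff by (simp_all add: diffeomorphism_def \<sigma>_def)
    have \<sigma>: "\<pi> (\<sigma> (y, h)) = y" if "y \<in> N" for y h
      using bij_betw_inv_into_right[OF bij, of "(y, h)"] that by (simp add: \<sigma>_def)
    have NU: "open (N \<times> (UNIV :: 'g set))" using N(1) open_UNIV by (rule open_Times)
    define M where "M = N \<times> UNIV \<inter> \<sigma> -` (\<pi> -` U)"
    \<comment> \<open>\<open>\<sigma>\<close> inverts the trivialization, so the group coordinate
      does not affect membership in \<open>M\<close>, and its slice at the unit is all of
      \<open>N \<inter> U\<close>.\<close>
    have "M = (N \<inter> U) \<times> UNIV" using \<sigma> by (auto simp: M_def)
    then have M: "open M" "\<And>c. {y. (y, c) \<in> M} = N \<inter> U"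
      using N(1) U by (auto intro: open_Times)
    have "smooth_fun (prod_atlas AB AG) M (H \<circ> \<sigma>)"
      unfolding M_def
      using smooth_fun_pullback[OF open_charts_prod_atlas[OF chaplygin_charts(2,3)]
          chaplygin_charts(1) sm H NU open_projection_vimage[OF U]] .
    from smooth_fun_slice1[OF chaplygin_charts(2,3) this M(1), of "\<one>\<^bsub>G\<^esub>"]
    have "smooth_fun AB (N \<inter> U) (\<lambda>y. (H \<circ> \<sigma>) (y, \<one>\<^bsub>G\<^esub>))"
      unfolding M(2) .
    then have "smooth_fun AB (N \<inter> U) f"
      by (rule smooth_fun_cong[OF chaplygin_charts(2)]) (use N U f \<sigma> in auto)
    then show "\<exists>M. open M \<and> x \<in> M \<and> smooth_fun AB M f"
      using N U x by (intro exI[of _ "N \<inter> U"]) auto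
  qed
  then show ?thesis using f by blast
qed

section \<open>Horizontal vectors, lifts and brackets under the group action\<close>

lemma chaplygin_connection:
  "invariant_distribution AQ \<Phi> D" "D q \<inter> vertical AQ AB \<pi> q = {0}"
  "subspace (D q)" "D q \<subseteq> tangent_space AQ q"
proof -
  have c: "principal_connection AQ AB \<Phi> \<pi> D"
    using system by (simp add: chaplygin_system_def)
  then show "invariant_distribution AQ \<Phi> D" and i: "D q \<inter> vertical AQ AB \<pi> q = {0}"
    by (simp_all add: principal_connection_def)
  have "distribution AQ DIM(real^'m) D" using c by (simp add: principal_connection_def)
  then have "\<exists>S. D q = span S"
    unfolding distribution_def by (elim allE[of _ q]) auto
  then show "subspace (D q)" by auto
  have sum: "{u + v | u v. u \<in> D q \<and> v \<in> vertical AQ AB \<pi> q} = tangent_space AQ q"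
    using c by (simp add: principal_connection_def)
  show "D q \<subseteq> tangent_space AQ q"
  proof
    fix u assume "u \<in> D q"
    then have "u + 0 \<in> {u + v | u v. u \<in> D q \<and> v \<in> vertical AQ AB \<pi> q}" using i by blast
    then show "u \<in> tangent_space AQ q" unfolding sum by (simp only: add_0_right)
  qed
qed

text \<open>The difference is horizontal and projects to 0, so it lies in both summands of the
  splitting.\<close>

lemma horizontal_eqI:
  assumes u: "u \<in> D q" and w: "w \<in> D q" and eq: "pushforward AB \<pi> q u = pushforward AB \<pi> q w"
  shows "u = w"
proof -
  have "u - w \<in> D q" using subspace_diff[OF chaplygin_connection(3) u w] .
  moreover have "pushforward AB \<pi> q (u - w) = 0"
    using eq by (auto simp: pushforward_def fun_eq_iff split: if_splits)
  ultimately have "u - w \<in> D q \<inter> vertical AQ AB \<pi> q"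
    using chaplygin_connection(4) by (auto simp: vertical_def)
  then show ?thesis using chaplygin_connection(2) by auto
qed

text \<open>By \<open>\<pi> \<circ> \<Phi> h = \<pi>\<close> both sides evaluate \<open>u\<close> on
  \<open>f \<circ> \<pi>\<close>. Smoothness of \<open>\<pi>\<close> ensures that the inner
  \<open>pushforward\<close> is not at its default value 0.\<close>

lemma pushforward_projection_action:
  "pushforward AB \<pi> (\<Phi> h q) (pushforward AQ (\<Phi> h) q u) = pushforward AB \<pi> q u"
proof
  fix f
  have "f \<circ> \<pi> \<in> smooth_near AQ (\<Phi> h q)" if "f \<in> smooth_near AB (\<pi> q)"
    using smooth_near_pullback[OF chaplygin_charts(1,2) projection_smooth, of f "\<Phi> h q"] that by simp
  moreover have "f \<circ> \<pi> \<circ> \<Phi> h = f \<circ> \<pi>" by auto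
  ultimately show "pushforward AB \<pi> (\<Phi> h q) (pushforward AQ (\<Phi> h) q u) f = pushforward AB \<pi> q u f"
    by (simp add: pushforward_def)
qed

lemma horizontal_lift_invariant:
  assumes X: "horizontal_lift AQ AB \<pi> D U Y X" and q: "q \<in> \<pi> -` U"
  shows "X (\<Phi> h q) = pushforward AQ (\<Phi> h) q (X q)"
proof (rule horizontal_eqI)
  have "X p \<in> D p" "pushforward AB \<pi> p (X p) = Y (\<pi> p)" if "\<pi> p \<in> U" for p
    using X that by (auto simp: horizontal_lift_def)
  moreover have "pushforward AQ (\<Phi> h) q ` D q = D (\<Phi> h q)"
    using chaplygin_connection(1) by (simp add: invariant_distribution_def)
  ultimately show "X (\<Phi> h q) \<in> D (\<Phi> h q)" "pushforward AQ (\<Phi> h) q (X q) \<in> D (\<Phi> h q)"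
    "pushforward AB \<pi> (\<Phi> h q) (X (\<Phi> h q)) =
      pushforward AB \<pi> (\<Phi> h q) (pushforward AQ (\<Phi> h) q (X q))"
    using q by (auto simp: pushforward_projection_action)
qed

text \<open>This is naturality of the bracket: each lift is related to itself by
  \<open>\<Phi> h\<close>. The fact \<open>deriv\<close> moves an iterated derivative through the
  translation and is used with the two fields in either order.\<close>

lemma lie_bracket_invariant:
  assumes U: "open U" and X: "horizontal_lift AQ AB \<pi> D U X' X"
    and Y: "horizontal_lift AQ AB \<pi> D U Y' Y" and q: "q \<in> \<pi> -` U"
  shows "lie_bracket AQ X Y (\<Phi> h q) = pushforward AQ (\<Phi> h) q (lie_bracket AQ X Y q)"
proof
  fix f
  have deriv: "Z (\<Phi> h q) (\<lambda>x. T x f) = Z q (\<lambda>x. T x (f \<circ> \<Phi> h))"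
    if f: "f \<in> smooth_near AQ (\<Phi> h q)"
      and Z: "horizontal_lift AQ AB \<pi> D U Z' Z" and T: "horizontal_lift AQ AB \<pi> D U T' T"
    for Z Z' T T'
  proof -
    obtain N where N: "open N" "\<Phi> h q \<in> N" "smooth_fun AQ N f"
      using f by (auto simp: smooth_near_def)
    have oN: "open (N \<inter> \<pi> -` U)" using N(1) open_projection_vimage[OF U] by auto
    have "smooth_fun AQ (N \<inter> \<pi> -` U) (\<lambda>x. T x f)"
      using T oN smooth_fun_subset[OF N(3), of "N \<inter> \<pi> -` U"]
      by (simp add: horizontal_lift_def smooth_vfield_def)
    then have near: "(\<lambda>x. T x f) \<in> smooth_near AQ (\<Phi> h q)"
      by (rule smooth_nearI[OF chaplygin_charts(1) _ oN]) (use N q in simp)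
    have "Z (\<Phi> h q) (\<lambda>x. T x f) = Z q ((\<lambda>x. T x f) \<circ> \<Phi> h)"
      using near by (simp add: horizontal_lift_invariant[OF Z q] pushforward_def)
    \<comment> \<open>The two functions are known to agree only near \<open>q\<close>: invariance of
      \<open>T\<close> holds over \<open>U\<close>, and \<open>pushforward\<close> evaluates
      \<open>f\<close> only where \<open>f\<close> is smooth. Locality of derivations closes the
      gap.\<close>
    also have "\<dots> = Z q (\<lambda>x. T x (f \<circ> \<Phi> h))"
    proof (rule tangent_space_local[where v = "Z q" and p = q, OF chaplygin_charts(1)])
      show "Z q \<in> tangent_space AQ q"
        using Z q by (simp add: horizontal_lift_def smooth_vfield_def)
      show "(\<lambda>x. T x f) \<circ> \<Phi> h \<in> smooth_near AQ q" using action_near(1)[OF near] .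
      show "open (\<Phi> h -` (N \<inter> \<pi> -` U))" "q \<in> \<Phi> h -` (N \<inter> \<pi> -` U)"
        using open_action_vimage[OF oN] q N(2) by auto
      show "((\<lambda>x. T x f) \<circ> \<Phi> h) x = T x (f \<circ> \<Phi> h)" if "x \<in> \<Phi> h -` (N \<inter> \<pi> -` U)" for x
        using that smooth_nearI[OF chaplygin_charts(1) N(3,1), of "\<Phi> h x"]
        by (simp add: horizontal_lift_invariant[OF T] pushforward_def)
    qed
    finally show ?thesis .
  qed
  show "lie_bracket AQ X Y (\<Phi> h q) f = pushforward AQ (\<Phi> h) q (lie_bracket AQ X Y q) f"
    using deriv[OF _ X Y] deriv[OF _ Y X] action_near(1)[of f h q]
    by (simp add: lie_bracket_def pushforward_def)
qed

lemma infinitesimal_generator_tangent: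
  assumes "\<xi> \<in> tangent_space AG \<one>\<^bsub>G\<^esub>"
  shows "infinitesimal_generator AQ G \<Phi> \<xi> q \<in> tangent_space AQ q"
  using pushforward_tangent[OF chaplygin_charts(1) action_near(2) assms, of q]
  by (simp add: infinitesimal_generator_def action_one)

text \<open>Component \<open>b\<close> of \<open>\<kappa>\<close>, composed with
  \<open>\<pi>\<close>, is a test function on which \<open>X a q\<close> takes the Kronecker delta,
  so it picks out \<open>c b\<close> from the combination.\<close>

lemma coord_lifts_independent:
  assumes U: "(U, \<kappa>) \<in> AB"
    and X: "\<And>a. horizontal_lift AQ AB \<pi> D U (coord_field AB U \<kappa> a) (X a)"
    and q: "q \<in> \<pi> -` U" and zero: "(\<Sum>a\<in>UNIV. c a *\<^sub>R X a q) = 0"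
  shows "c b = 0"
proof -
  have AB: "manifold AB" using system by (simp add: chaplygin_system_def)
  define y where "y x = \<kappa> x $ b" for x
  have "y \<in> smooth_near AB (\<pi> q)"
    using smooth_nearI[OF chaplygin_charts(2) chart_component_smooth[OF AB U]] q
      chart_props(1)[OF chaplygin_charts(2) U] by (simp add: y_def[abs_def])
  then have "X a q (y \<circ> \<pi>) = pushforward AB \<pi> q (X a q) y" for a
    by (simp add: pushforward_def)
  also have "pushforward AB \<pi> q (X a q) y = (if a = b then 1 else 0)" for a
    using X[of a] q coord_field_component[OF AB U, of "\<pi> q" a b]
    by (simp add: horizontal_lift_def y_def[abs_def])
  finally have Xy: "X a q (y \<circ> \<pi>) = (if a = b then 1 else 0)" for a .
  have "(\<Sum>a\<in>UNIV. c a *\<^sub>R X a q) (y \<circ> \<pi>) = c b"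
    by (simp add: sum_fun_apply Xy if_distrib cong: if_cong)
  then show ?thesis using zero by simp
qed

end

text \<open>A single choice of \<open>f\<close>, \<open>\<gamma>\<close> and \<open>S\<close> serves
  all clauses. They are tied to \<open>F\<close>, the metric and the curvature term, so the reduced
  condition is (A') with each lift replaced by its coordinate field, not merely some equivalent
  statement on the base.\<close>

theorem lemma3:
  fixes AQ :: "('q::{t2_space,second_countable_topology}, real^'n::finite) atlas"
    and AB :: "('b::{t2_space,second_countable_topology}, real^'m::finite) atlas"
    and AG :: "('g::{t2_space,second_countable_topology}, real^'k::finite) atlas"
    and G :: "'g monoid"
    and \<Phi> :: "'g \<Rightarrow> 'q \<Rightarrow> 'q"
    and \<pi> :: "'q \<Rightarrow> 'b"
    and g g' :: "'q tensor2"
    and D :: "'q \<Rightarrow> 'q tvec set"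
    and F :: "'q \<Rightarrow> real"
    and U :: "'b set" and \<kappa> :: "'b \<Rightarrow> real^'m"
    and X :: "'m \<Rightarrow> 'q vfield"
    and \<xi> :: "'k \<Rightarrow> 'g tvec"
    and V :: "'k \<Rightarrow> 'q vfield"
    and E :: "'m + 'k \<Rightarrow> 'q vfield"
    and R :: "'m + 'k \<Rightarrow> 'm + 'k \<Rightarrow> 'm + 'k \<Rightarrow> 'q \<Rightarrow> real"
  assumes system: "chaplygin_system AQ AB AG G \<Phi> \<pi> g D"
    and chart: "(U, \<kappa>) \<in> AB"
    and lifts: "\<And>a. horizontal_lift AQ AB \<pi> D U (coord_field AB U \<kappa> a) (X a)"
    and basis: "lie_algebra_basis AG G \<xi>"
    and generators: "\<And>i. V i = infinitesimal_generator AQ G \<Phi> (\<xi> i)"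
    and frame: "E = adapted_frame g X V"
    and R: "structure_functions AQ (\<pi> -` U) E R"
    and modification: "D_preserving_modification AQ D g g'"
    and F_smooth: "smooth_fun AQ UNIV F"
    and g'_invariant: "invariant_tensor AQ \<Phi> g'"
    and F_invariant: "invariant_fun_on \<Phi> UNIV F"
  shows "(\<forall>a b c. invariant_fun_on \<Phi> (\<pi> -` U) (A'_lhs g g' F E R a b c)) \<and>
    (\<exists>f \<gamma> S.
       smooth_fun AB UNIV f \<and> (\<forall>q. F q = f (\<pi> q)) \<and>
       (\<forall>a b. smooth_fun AB U (\<gamma> a b) \<and>
              (\<forall>q\<in>\<pi> -` U. g q (X a q) (X b q) = \<gamma> a b (\<pi> q))) \<and>
       (\<forall>b a c. smooth_fun AB U (S b a c) \<and>
              (\<forall>q\<in>\<pi> -` U. curvature_term g' E R b a c q = S b a c (\<pi> q))) \<and>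
       (\<forall>a b c. \<forall>q\<in>\<pi> -` U. A'_lhs g g' F E R a b c q =
          S b a c (\<pi> q) + S a b c (\<pi> q)
          - \<gamma> b c (\<pi> q) * coord_field AB U \<kappa> a (\<pi> q) f
          - \<gamma> a c (\<pi> q) * coord_field AB U \<kappa> b (\<pi> q) f
          + 2 * \<gamma> a b (\<pi> q) * coord_field AB U \<kappa> c (\<pi> q) f) \<and>
       ((\<forall>q\<in>\<pi> -` U. \<forall>a b c. A'_lhs g g' F E R a b c q = 0) \<longleftrightarrow>
        (\<forall>x\<in>U. \<forall>a b c.
          S b a c x + S a b c x
          - \<gamma> b c x * coord_field AB U \<kappa> a x f
          - \<gamma> a c x * coord_field AB U \<kappa> b x f
          + 2 * \<gamma> a b x * coord_field AB U \<kappa> c x f = 0)))"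
proof -
  note charts = chaplygin_charts[OF system]
  define W where "W = \<pi> -` U"
  have U: "open U" using chart_props(1)[OF charts(2) chart] .
  have W: "open W" unfolding W_def using open_projection_vimage[OF system U] .
  have g: "riemannian_metric AQ g" "invariant_tensor AQ \<Phi> g"
    using system by (simp_all add: chaplygin_system_def)
  have sym: "sym_tensor AQ g" "sym_tensor AQ g'"
    using g modification by (simp_all add: riemannian_metric_def D_preserving_modification_def)
  have X: "smooth_vfield AQ W (X a)" for a
    using lifts[of a] by (simp add: horizontal_lift_def W_def)
  have XT: "X a q \<in> tangent_space AQ q" and XD: "X a q \<in> D q"
    and X\<pi>: "pushforward AB \<pi> q (X a q) = coord_field AB U \<kappa> a (\<pi> q)" if "q \<in> W" for a q
    using lifts[of a] that by (auto simp: horizontal_lift_def smooth_vfield_def W_def)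
  have V: "V i q \<in> tangent_space AQ q" for i q
  proof -
    have "\<xi> i \<in> span (range \<xi>)" by (intro span_base) simp
    then have "\<xi> i \<in> tangent_space AG \<one>\<^bsub>G\<^esub>"
      using basis by (simp add: lie_algebra_basis_def)
    then show ?thesis
      unfolding generators by (rule infinitesimal_generator_tangent[OF system])
  qed
  define Br where "Br a c = lie_bracket AQ (X a) (X c)" for a c
  have R': "structure_functions AQ W (adapted_frame g X V) R"
    using R unfolding frame W_def .
  have indep: "\<forall>r. (\<Sum>a\<in>UNIV. r a *\<^sub>R X a q) = 0 \<longrightarrow> (\<forall>b. r b = 0)" if "q \<in> W" for q
    using coord_lifts_independent[OF system chart lifts] that unfolding W_def by blast
  have BrT: "Br a c q \<in> tangent_space AQ q"
    and curv: "curvature_term g' E R b a c q = g' q (X b q) (Br a c q) - g q (X b q) (Br a c q)"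
    if "q \<in> W" for a b c q
    unfolding Br_def frame
    using curvature_term_eq[where X = X and V = V and q = q, OF g(1) modification XT[OF that] XD[OF that] indep[OF that] V R' that]
    by blast+
  have Br: "smooth_vfield AQ W (Br a c)" for a c
    unfolding Br_def
    using X X BrT[unfolded Br_def] by (rule lie_bracket_smooth_vfield[OF charts(1)])
  have X_inv: "X a (\<Phi> h q) = pushforward AQ (\<Phi> h) q (X a q)" if "q \<in> W" for a h q
    using horizontal_lift_invariant[OF system lifts] that unfolding W_def .
  have Br_inv: "Br a c (\<Phi> h q) = pushforward AQ (\<Phi> h) q (Br a c q)" if "q \<in> W" for a c h q
    unfolding Br_def
    using lie_bracket_invariant[OF system U lifts lifts] that unfolding W_def .
  have inv: "t (\<Phi> h q) (X b (\<Phi> h q)) (X c (\<Phi> h q)) = t q (X b q) (X c q)"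
    "t (\<Phi> h q) (X b (\<Phi> h q)) (Br a c (\<Phi> h q)) = t q (X b q) (Br a c q)"
    if "invariant_tensor AQ \<Phi> t" "q \<in> W" for t h q a b c
    using that XT BrT by (simp_all add: X_inv Br_inv invariant_tensor_def)
  have smooth: "smooth_fun AQ W (\<lambda>q. t q (Y q) (Z q))"
    if "sym_tensor AQ t" "smooth_vfield AQ W Y" "smooth_vfield AQ W Z" for t Y Z
    using that W unfolding sym_tensor_def by blast

  \<comment> \<open>\<open>F\<close> is smooth and invariant globally, hence \<open>f\<close> is
    global; the other coefficients involve the coordinate lifts and live over
    \<open>U\<close>.\<close>
  have "\<exists>f. smooth_fun AB UNIV f \<and> (\<forall>q\<in>\<pi> -` UNIV. F q = f (\<pi> q))"
    by (rule invariant_fun_descends[OF system open_UNIV])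
      (use F_smooth F_invariant in simp_all)
  then obtain f where f: "smooth_fun AB UNIV f" "\<And>q. F q = f (\<pi> q)" by auto

  have "\<exists>s. smooth_fun AB U s \<and> (\<forall>q\<in>W. g q (X a q) (X b q) = s (\<pi> q))" for a b
    unfolding W_def
    by (rule invariant_fun_descends[OF system U])
      (use smooth[OF sym(1) X X] inv(1)[OF g(2)] in \<open>auto simp: invariant_fun_on_def W_def\<close>)
  then obtain \<gamma> where \<gamma>: "\<And>a b. smooth_fun AB U (\<gamma> a b)"
    "\<And>a b q. q \<in> W \<Longrightarrow> g q (X a q) (X b q) = \<gamma> a b (\<pi> q)" by metis

  \<comment> \<open>Descent is applied to the right side of \<open>curv\<close>, built from
    invariant tensors, lifts and brackets; \<open>curv\<close> then carries the result over to
    \<open>curvature_term\<close>.\<close>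
  have "\<exists>s. smooth_fun AB U s \<and> (\<forall>q\<in>W. g' q (X b q) (Br a c q) - g q (X b q) (Br a c q) = s (\<pi> q))"
    for b a c
    unfolding W_def
    by (rule invariant_fun_descends[OF system U])
      (use smooth_fun_diff[OF charts(1) smooth[OF sym(2) X Br] smooth[OF sym(1) X Br] W]
        inv(2)[OF g(2)] inv(2)[OF g'_invariant] in \<open>auto simp: invariant_fun_on_def W_def\<close>)
  then obtain S where S: "\<And>b a c. smooth_fun AB U (S b a c)"
    "\<And>b a c q. q \<in> W \<Longrightarrow> curvature_term g' E R b a c q = S b a c (\<pi> q)"
    using curv by metis

  have XF: "X a q F = coord_field AB U \<kappa> a (\<pi> q) f" if "q \<in> W" for a q
  proof -
    have "f \<in> smooth_near AB (\<pi> q)" using smooth_nearI[OF charts(2) f(1)] by simp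
    moreover have "F = f \<circ> \<pi>" using f(2) by auto
    ultimately have "X a q F = pushforward AB \<pi> q (X a q) f" by (simp add: pushforward_def)
    then show ?thesis by (simp add: X\<pi>[OF that])
  qed

  define T where "T a b c x = S b a c x + S a b c x
      - \<gamma> b c x * coord_field AB U \<kappa> a x f
      - \<gamma> a c x * coord_field AB U \<kappa> b x f
      + 2 * \<gamma> a b x * coord_field AB U \<kappa> c x f" for a b c x
  have EX: "E (Inl a) = X a" for a by (simp add: frame adapted_frame_def fun_eq_iff)
  have A': "A'_lhs g g' F E R a b c q = T a b c (\<pi> q)" if "q \<in> W" for a b c q
    unfolding A'_lhs_def T_def EX using that by (simp add: S(2) \<gamma>(2) XF)
  \<comment> \<open>Invariance is read off from the factorization of the whole left-hand side
    through \<open>\<pi>\<close>.\<close>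
  have "invariant_fun_on \<Phi> W (A'_lhs g g' F E R a b c)" for a b c
    unfolding invariant_fun_on_def
    using A' by (simp add: W_def projection_action[OF system])
  moreover have "(\<forall>q\<in>W. \<forall>a b c. A'_lhs g g' F E R a b c q = 0) \<longleftrightarrow>
      (\<forall>x\<in>U. \<forall>a b c. T a b c x = 0)"
  proof -
    \<comment> \<open>Every point of \<open>U\<close> must be hit by some \<open>q\<close> for the
      condition upstairs to give the one on the base.\<close>
    have "\<pi> ` W = U" unfolding W_def using projection_surj[OF system] by (rule surj_image_vimage_eq)
    then show ?thesis using A' by auto
  qed
  ultimately show ?thesis
    unfolding W_def[symmetric] T_def[symmetric]
    using f \<gamma> S A'[unfolded T_def]
    by (intro conjI exI[of _ f] exI[of _ \<gamma>] exI[of _ S]) (auto simp: T_def)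
qed

end
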